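(* Let $M$ be a nonempty set of mutually orthogonal self-adjoint elements of a von Neumann algebra $\mathcal{M}$, and let $\mathcal{F}=\{F\subseteq M : F\text{ finite and nonempty}\}$. If $M$ is bounded above in $(\mathcal{M}_{sa},\preceq)$ and $M$ is not a singleton, then $$\sup_{x\in M}x=\operatorname{s-lim}_{F\in\mathcal{F}}\sum_{x\in F}x^+,$$ where $x^+$ is the positive part of $x$ and the supremum is taken in $(\mathcal{M}_{sa},\preceq)$.
   Context: A von Neumann algebra $\mathcal{M}$ is a strongly operator closed C*-subalgebra of $\mathcal{B}(\mathcal{H})$, $\mathcal{H}$ a complex Hilbert space; $\mathcal{M}_{sa}$ is its self-adjoint part. For $x\in\mathcal{M}_{sa}$, $(E^x_\lambda)_{\lambda\in\mathbb{R}}$ denotes its (right-continuous) spectral family: $E^x_\lambda$ is the spectral projection of $x$ for $(-\infty,\lambda]$. The spectral order $\preceq$ on $\mathcal{M}_{sa}$ is defined by: $x\preceq y$ iff $E^y_\lambda\le E^x_\lambda$ for every $\lambda\in\mathbb{R}$. In $(\mathcal{M}_{sa},\preceq)$ every nonempty set bounded above has a supremum. Self-adjoint operators $x,y$ are orthogonal if $xy=0$; the elements of $M$ are mutually orthogonal if any two distinct elements of $M$ are orthogonal. $\operatorname{s-lim}$ is the limit in the strong operator topology; $\mathcal{F}$ is directed by inclusion. *)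

theory Defs
  imports "HOL-Analysis.Analysis"
begin

section \<open>Complex Hilbert spaces\<close>

text \<open>The inner product is linear in the first and conjugate-linear in the second argument.\<close>

class complex_hilbert_space = banach +
  fixes scaleC :: "complex \<Rightarrow> 'a \<Rightarrow> 'a"  (infixr \<open>*\<^sub>C\<close> 75)
    and cinner :: "'a \<Rightarrow> 'a \<Rightarrow> complex"
  assumes scaleC_add_right: "a *\<^sub>C (x + y) = a *\<^sub>C x + a *\<^sub>C y"
    and scaleC_add_left: "(a + b) *\<^sub>C x = a *\<^sub>C x + b *\<^sub>C x"
    and scaleC_scaleC: "a *\<^sub>C (b *\<^sub>C x) = (a * b) *\<^sub>C x"
    and scaleR_scaleC: "r *\<^sub>R x = complex_of_real r *\<^sub>C x"
    and cinner_commute: "cinner x y = cnj (cinner y x)"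
    and cinner_add_left: "cinner (x + y) z = cinner x z + cinner y z"
    and cinner_scaleC_left: "cinner (a *\<^sub>C x) y = a * cinner x y"
    and cinner_nonneg: "cinner x x \<in> \<real>\<^sub>\<ge>\<^sub>0"
    and norm_eq_sqrt_cinner: "norm x = sqrt (Re (cinner x x))"

section \<open>Bounded operators\<close>

text \<open>The library type \<open>'a \<Rightarrow>\<^sub>L 'a\<close> consists of the bounded real-linear maps; the algebra of bounded
  operators on the complex space is the set of those that are complex-linear. Operator norm,
  composition and the strong operator topology are inherited from the library.\<close>

definition bounded_ops :: "('a::complex_hilbert_space \<Rightarrow>\<^sub>L 'a) set" where
  "bounded_ops = {T :: 'a \<Rightarrow>\<^sub>L 'a. \<forall>c \<xi>. T (c *\<^sub>C \<xi>) = c *\<^sub>C T \<xi>}"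

definition is_adjoint :: "('a::complex_hilbert_space \<Rightarrow>\<^sub>L 'a) \<Rightarrow> ('a \<Rightarrow>\<^sub>L 'a) \<Rightarrow> bool" where
  "is_adjoint S T \<longleftrightarrow> (\<forall>\<xi> \<eta>. cinner (S \<xi>) \<eta> = cinner \<xi> (T \<eta>))"

definition selfadjoint :: "('a::complex_hilbert_space \<Rightarrow>\<^sub>L 'a) \<Rightarrow> bool" where
  "selfadjoint T \<longleftrightarrow> T \<in> bounded_ops \<and> is_adjoint T T"

definition positive_op :: "('a::complex_hilbert_space \<Rightarrow>\<^sub>L 'a) \<Rightarrow> bool" where
  "positive_op T \<longleftrightarrow> T \<in> bounded_ops \<and> (\<forall>\<xi>. cinner (T \<xi>) \<xi> \<in> \<real>\<^sub>\<ge>\<^sub>0)"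

definition op_le :: "('a::complex_hilbert_space \<Rightarrow>\<^sub>L 'a) \<Rightarrow> ('a \<Rightarrow>\<^sub>L 'a) \<Rightarrow> bool" where
  "op_le S T \<longleftrightarrow> positive_op (T - S)"

definition projection_op :: "('a::complex_hilbert_space \<Rightarrow>\<^sub>L 'a) \<Rightarrow> bool" where
  "projection_op P \<longleftrightarrow> selfadjoint P \<and> P o\<^sub>L P = P"

section \<open>Von Neumann algebras\<close>

text \<open>Algebras are not required to contain the identity operator of the ambient space.\<close>

definition cstar_subalgebra :: "('a::complex_hilbert_space \<Rightarrow>\<^sub>L 'a) set \<Rightarrow> bool" where
  "cstar_subalgebra A \<longleftrightarrow>
     A \<subseteq> bounded_ops \<and> 0 \<in> A \<and>
     (\<forall>S\<in>A. \<forall>T\<in>A. S + T \<in> A) \<and>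
     (\<forall>c. \<forall>T\<in>A. \<exists>S\<in>A. \<forall>\<xi>. S \<xi> = c *\<^sub>C T \<xi>) \<and>
     (\<forall>S\<in>A. \<forall>T\<in>A. S o\<^sub>L T \<in> A) \<and>
     (\<forall>T\<in>A. \<exists>S\<in>A. is_adjoint S T) \<and>
     closed A"

definition von_neumann_algebra :: "('a::complex_hilbert_space \<Rightarrow>\<^sub>L 'a) set \<Rightarrow> bool" where
  "von_neumann_algebra A \<longleftrightarrow> cstar_subalgebra A \<and> closedin strong_operator_topology A"

definition sa_part :: "('a::complex_hilbert_space \<Rightarrow>\<^sub>L 'a) set \<Rightarrow> ('a \<Rightarrow>\<^sub>L 'a) set" where
  "sa_part A = {x\<in>A. selfadjoint x}"

section \<open>Spectral families\<close>

text \<open>\<open>has_spectral_integral f E T\<close> means \<open>T = \<integral> f(\<lambda>) dE(\<lambda>)\<close>: the Riemann--Stieltjes sums of \<open>f\<close>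
  (a continuous function) converge to \<open>T\<close> in operator norm as the mesh of the partition
  \<open>p 0 \<le> \<dots> \<le> p n\<close> with tags \<open>t i\<close> tends to 0. Only partitions that exhaust a boundedly supported
  family \<open>E\<close> are used, that is, \<open>E (p 0) = 0\<close> and \<open>E (p n) = 1\<close>.\<close>

definition has_spectral_integral ::
    "(real \<Rightarrow> real) \<Rightarrow> (real \<Rightarrow> 'a::complex_hilbert_space \<Rightarrow>\<^sub>L 'a) \<Rightarrow> ('a \<Rightarrow>\<^sub>L 'a) \<Rightarrow> bool" where
  "has_spectral_integral f E T \<longleftrightarrow>
     (\<forall>\<epsilon>>0. \<exists>\<delta>>0. \<forall>(n::nat) p t.
        E (p 0) = 0 \<and> E (p n) = id_blinfun \<and>
        (\<forall>i<n. p i \<le> t i \<and> t i \<le> p (Suc i) \<and> p (Suc i) - p i < \<delta>) \<longrightarrow>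
        norm ((\<Sum>i<n. f (t i) *\<^sub>R (E (p (Suc i)) - E (p i))) - T) < \<epsilon>)"

definition spectral_resolution ::
    "('a::complex_hilbert_space \<Rightarrow>\<^sub>L 'a) \<Rightarrow> (real \<Rightarrow> 'a \<Rightarrow>\<^sub>L 'a) \<Rightarrow> bool" where
  "spectral_resolution x E \<longleftrightarrow>
     (\<forall>l. projection_op (E l)) \<and>
     (\<forall>l m. l \<le> m \<longrightarrow> op_le (E l) (E m)) \<and>
     (\<forall>l. limitin strong_operator_topology E (E l) (at_right l)) \<and>
     (\<exists>a b. (\<forall>l<a. E l = 0) \<and> (\<forall>l\<ge>b. E l = id_blinfun)) \<and>
     has_spectral_integral (\<lambda>l. l) E x"

text \<open>By the spectral theorem, a bounded self-adjoint operator has exactly one right-continuous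
  resolution of the identity; its value at \<open>l\<close> is the spectral projection for \<open>(-\<infinity>, l]\<close>.\<close>

definition spectral_family ::
    "('a::complex_hilbert_space \<Rightarrow>\<^sub>L 'a) \<Rightarrow> real \<Rightarrow> 'a \<Rightarrow>\<^sub>L 'a" where
  "spectral_family x = (THE E. spectral_resolution x E)"

text \<open>The positive part \<open>x\<^sup>+ = f(x)\<close> for \<open>f(\<lambda>) = max(\<lambda>, 0)\<close>, by functional calculus.\<close>

definition pos_part :: "('a::complex_hilbert_space \<Rightarrow>\<^sub>L 'a) \<Rightarrow> ('a \<Rightarrow>\<^sub>L 'a)" where
  "pos_part x = (THE T. has_spectral_integral (\<lambda>l. max l 0) (spectral_family x) T)"

section \<open>The spectral order\<close>

definition spectral_le :: "('a::complex_hilbert_space \<Rightarrow>\<^sub>L 'a) \<Rightarrow> ('a \<Rightarrow>\<^sub>L 'a) \<Rightarrow> bool"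
    (infix \<open>\<preceq>\<^sub>s\<close> 50) where
  "x \<preceq>\<^sub>s y \<longleftrightarrow> (\<forall>l. op_le (spectral_family y l) (spectral_family x l))"

definition spectral_bdd_above ::
    "('a::complex_hilbert_space \<Rightarrow>\<^sub>L 'a) set \<Rightarrow> ('a \<Rightarrow>\<^sub>L 'a) set \<Rightarrow> bool" where
  "spectral_bdd_above A M \<longleftrightarrow> (\<exists>u\<in>sa_part A. \<forall>x\<in>M. x \<preceq>\<^sub>s u)"

definition is_spectral_sup ::
    "('a::complex_hilbert_space \<Rightarrow>\<^sub>L 'a) set \<Rightarrow> ('a \<Rightarrow>\<^sub>L 'a) set \<Rightarrow> ('a \<Rightarrow>\<^sub>L 'a) \<Rightarrow> bool" where
  "is_spectral_sup A M s \<longleftrightarrow>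
     s \<in> sa_part A \<and> (\<forall>x\<in>M. x \<preceq>\<^sub>s s) \<and> (\<forall>u\<in>sa_part A. (\<forall>x\<in>M. x \<preceq>\<^sub>s u) \<longrightarrow> s \<preceq>\<^sub>s u)"

definition spectral_Sup ::
    "('a::complex_hilbert_space \<Rightarrow>\<^sub>L 'a) set \<Rightarrow> ('a \<Rightarrow>\<^sub>L 'a) set \<Rightarrow> ('a \<Rightarrow>\<^sub>L 'a)" where
  "spectral_Sup A M = (THE s. is_spectral_sup A M s)"

section \<open>Nets indexed by the finite nonempty subsets\<close>

definition finite_nonempty_subsets :: "'b set \<Rightarrow> 'b set set" where
  "finite_nonempty_subsets M = {F. finite F \<and> F \<noteq> {} \<and> F \<subseteq> M}"

definition finite_nonempty_subsets_at_top :: "'b set \<Rightarrow> 'b set filter" where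
  "finite_nonempty_subsets_at_top M =
     (INF F\<in>finite_nonempty_subsets M. principal {G\<in>finite_nonempty_subsets M. F \<subseteq> G})"

lemma eventually_finite_nonempty_subsets_at_top:
  assumes "M \<noteq> {}"
  shows "eventually P (finite_nonempty_subsets_at_top M) \<longleftrightarrow>
    (\<exists>F\<in>finite_nonempty_subsets M. \<forall>G\<in>finite_nonempty_subsets M. F \<subseteq> G \<longrightarrow> P G)"
proof -
  obtain x where "x \<in> M" using assms by auto
  then have "{x} \<in> finite_nonempty_subsets M"
    by (simp add: finite_nonempty_subsets_def)
  then have nonempty: "finite_nonempty_subsets M \<noteq> {}"
    by (metis empty_iff)
  have directed: "\<exists>H\<in>finite_nonempty_subsets M.
      principal {K\<in>finite_nonempty_subsets M. H \<subseteq> K}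
      \<le> inf (principal {K\<in>finite_nonempty_subsets M. F \<subseteq> K})
            (principal {K\<in>finite_nonempty_subsets M. G \<subseteq> K})"
    if "F \<in> finite_nonempty_subsets M" "G \<in> finite_nonempty_subsets M" for F G
  proof (rule bexI[of _ "F \<union> G"])
    show "F \<union> G \<in> finite_nonempty_subsets M"
      using that by (simp add: finite_nonempty_subsets_def)
  qed auto
  show ?thesis
    unfolding finite_nonempty_subsets_at_top_def
    by (subst eventually_INF_base[OF nonempty directed]) (simp_all add: eventually_principal Ball_def imp_conjL)
qed

end

theory Submission
  imports Defs
begin

text \<open>
  Two mutually orthogonal self-adjoint elements \<open>x\<close>, \<open>y\<close> have no common spectral subspace below 0:
  a vector \<open>v\<close> fixed by both spectral projections at some \<open>l < 0\<close> satisfies \<open>y v = 0\<close>, while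
  \<open>\<langle>y v, v\<rangle> \<le> l \<parallel>v\<parallel>\<^sup>2\<close>. So as soon as there are two elements, the spectral family of every upper bound
  vanishes on the negative half-line and only the positive parts matter. These live on mutually
  orthogonal supports and are bounded by a common constant, which makes their sums over finite subsets
  converge strongly (Pythagoras and Bessel) to a positive operator \<open>s\<close>, and strong closedness puts
  \<open>s\<close> into the algebra.

  That \<open>s\<close> is the supremum is then read off quadratic forms. A projection commuting with \<open>x\<close>
  is its spectral projection at \<open>l\<close> if and only if \<open>\<langle>x v, v\<rangle> \<le> l \<parallel>v\<parallel>\<^sup>2\<close> on the range and
  \<open>\<langle>x v, v\<rangle> > l \<parallel>v\<parallel>\<^sup>2\<close> on the kernel without 0, and for commuting operators these inequalities
  compare the spectral projections. The elements of \<open>M\<close> commute with \<open>s\<close>. Hence \<open>s\<close> is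
  an upper bound because \<open>x \<le> x\<^sup>+ \<le> s\<close>; and if every \<open>E\<^sup>x\<^sub>l\<close> fixes \<open>v\<close>, with \<open>l \<ge> 0\<close>, then each
  \<open>x\<^sup>+\<close> is at most \<open>l\<close> times its support at \<open>v\<close>, so by Bessel \<open>\<langle>s v, v\<rangle> \<le> l \<parallel>v\<parallel>\<^sup>2\<close>, which forces
  \<open>E\<^sup>s\<^sub>l v = v\<close> (lemma \<open>strong_sum_is_spectral_sup\<close>).

  The form characterisation (\<open>spectral_projection\<close>) also carries the spectral theorem. The projection
  at \<open>l\<close> is the kernel projection of \<open>\<bar>w\<bar> + w\<close> for a positive multiple \<open>w\<close> of \<open>x - l\<close>; the absolute
  value is a square root obtained from a norm-convergent iteration, the kernel projection is a strong
  limit of powers of a contraction. Since it commutes with everything that commutes with \<open>x\<close>, it is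
  the only projection with the two inequalities (\<open>spectral_projection_unique\<close>). The members of a
  spectral resolution satisfy them, and conversely they produce a resolution, so existence and
  uniqueness of the spectral family follow. The positive part becomes \<open>x (1 - E\<^sub>0)\<close>, a multiple of
  \<open>\<bar>w\<bar> + w\<close> for \<open>l = 0\<close>, which explains why it stays in a norm-closed algebra even without unit.
\<close>

section \<open>The inner product\<close>

definition re_inner :: "'a::complex_hilbert_space \<Rightarrow> 'a \<Rightarrow> real"  (infixl \<open>\<bullet>\<^sub>R\<close> 70) where
  "x \<bullet>\<^sub>R y = Re (cinner x y)"

lemma cinner_add_right: "cinner x (y + z) = cinner x y + cinner x z"
  by (metis cinner_add_left cinner_commute complex_cnj_add)

lemma cinner_scaleC_right: "cinner x (c *\<^sub>C y) = cnj c * cinner x y"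
  by (metis cinner_commute cinner_scaleC_left complex_cnj_mult)

lemma cinner_scaleR_left: "cinner (r *\<^sub>R x) y = r *\<^sub>R cinner x y"
  by (simp add: scaleR_scaleC cinner_scaleC_left scaleR_conv_of_real)

lemma cinner_scaleR_right: "cinner x (r *\<^sub>R y) = r *\<^sub>R cinner x y"
  by (simp add: scaleR_scaleC cinner_scaleC_right scaleR_conv_of_real)

lemma re_inner_commute: "x \<bullet>\<^sub>R y = y \<bullet>\<^sub>R x"
  unfolding re_inner_def by (subst cinner_commute) simp

lemma re_inner_self: "x \<bullet>\<^sub>R x = (norm x)\<^sup>2"
  using cinner_nonneg[of x] by (simp add: re_inner_def norm_eq_sqrt_cinner complex_nonneg_Reals_iff)

lemma re_inner_linear:
  "(x + y) \<bullet>\<^sub>R z = x \<bullet>\<^sub>R z + y \<bullet>\<^sub>R z" "x \<bullet>\<^sub>R (y + z) = x \<bullet>\<^sub>R y + x \<bullet>\<^sub>R z"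
  "(r *\<^sub>R x) \<bullet>\<^sub>R y = r * (x \<bullet>\<^sub>R y)" "x \<bullet>\<^sub>R (r *\<^sub>R y) = r * (x \<bullet>\<^sub>R y)"
  by (simp_all add: re_inner_def cinner_add_left cinner_add_right cinner_scaleR_left cinner_scaleR_right)

lemma norm_add_square: "(norm (x + y))\<^sup>2 = (norm x)\<^sup>2 + 2 * (x \<bullet>\<^sub>R y) + (norm y)\<^sup>2"
  for x y :: "'a::complex_hilbert_space"
  by (simp add: re_inner_self[symmetric] re_inner_linear re_inner_commute[of y x])

lemma re_inner_le_norm: "x \<bullet>\<^sub>R y \<le> norm x * norm y"
proof (cases "x = 0 \<or> y = 0")
  case True
  have "0 \<bullet>\<^sub>R v = 0" for v :: 'a
    using re_inner_linear(3)[of 0 0 v] by simp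
  with True show ?thesis by (auto simp: re_inner_commute[of _ 0])
next
  case False
  then have pos: "norm x > 0" "norm y > 0" by auto
  have "0 \<le> (norm (norm y *\<^sub>R x + (- norm x) *\<^sub>R y))\<^sup>2" by simp
  also have "\<dots> = 2 * (norm x * norm y) * (norm x * norm y - x \<bullet>\<^sub>R y)"
    by (simp only: norm_add_square re_inner_linear norm_scaleR)
       (simp add: algebra_simps power2_eq_square)
  finally show ?thesis
    using mult_pos_pos[OF pos] by (simp add: zero_le_mult_iff)
qed

lemma abs_re_inner_le_norm: "\<bar>x \<bullet>\<^sub>R y\<bar> \<le> norm x * norm y"
proof -
  have "- (x \<bullet>\<^sub>R y) = ((-1) *\<^sub>R x) \<bullet>\<^sub>R y" by (simp only: re_inner_linear)
  also have "\<dots> \<le> norm x * norm y" using re_inner_le_norm[of "(-1) *\<^sub>R x" y] by simp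
  finally show ?thesis using re_inner_le_norm[of x y] by simp
qed

lemma bounded_bilinear_re_inner: "bounded_bilinear ((\<bullet>\<^sub>R) :: 'a::complex_hilbert_space \<Rightarrow> 'a \<Rightarrow> real)"
proof
  show "\<exists>K. \<forall>x y :: 'a. norm (x \<bullet>\<^sub>R y) \<le> norm x * norm y * K"
    by (intro exI[of _ 1]) (simp add: abs_re_inner_le_norm)
qed (simp_all add: re_inner_linear)

interpretation re_inner: bounded_bilinear "(\<bullet>\<^sub>R) :: 'a::complex_hilbert_space \<Rightarrow> 'a \<Rightarrow> real"
  by (rule bounded_bilinear_re_inner)

lemmas re_inner_simps = re_inner.add_left re_inner.add_right re_inner.diff_left re_inner.diff_right
  re_inner.minus_left re_inner.minus_right re_inner.zero_left re_inner.zero_right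
  re_inner.scaleR_left re_inner.scaleR_right

lemma Im_cinner: "Im (cinner x y) = x \<bullet>\<^sub>R (\<i> *\<^sub>C y)"
  by (simp add: re_inner_def cinner_scaleC_right)

lemma norm_diff_square: "(norm (x - y))\<^sup>2 = (norm x)\<^sup>2 - 2 * (x \<bullet>\<^sub>R y) + (norm y)\<^sup>2"
  for x y :: "'a::complex_hilbert_space"
  using norm_add_square[of x "- y"] by (simp add: re_inner_simps)

lemma eq_0_if_re_inner_all: "x = 0" if "\<And>y. x \<bullet>\<^sub>R y = 0"
  using that[of x] by (simp add: re_inner_self)

section \<open>Self-adjoint operators\<close>

lemma selfadjoint_re_inner: "selfadjoint T \<Longrightarrow> T v \<bullet>\<^sub>R w = v \<bullet>\<^sub>R T w"
  by (simp add: selfadjoint_def is_adjoint_def re_inner_def)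

text \<open>Complex linearity comes for free, because \<open>\<langle>T (c v), w\<rangle> = c \<langle>v, T w\<rangle> = \<langle>c T v, w\<rangle>\<close> for all \<open>w\<close>.\<close>

lemma selfadjoint_iff: "selfadjoint T \<longleftrightarrow> (\<forall>v w. cinner (T v) w = cinner v (T w))"
proof
  assume adj: "\<forall>v w. cinner (T v) w = cinner v (T w)"
  have "T (c *\<^sub>C v) = c *\<^sub>C T v" for c v
  proof -
    have "(T (c *\<^sub>C v) - c *\<^sub>C T v) \<bullet>\<^sub>R w = 0" for w
      by (simp add: re_inner_simps) (simp add: re_inner_def cinner_scaleC_left adj)
    then show ?thesis using eq_0_if_re_inner_all by fastforce
  qed
  then show "selfadjoint T"
    using adj by (simp add: selfadjoint_def bounded_ops_def is_adjoint_def)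
qed (simp add: selfadjoint_def is_adjoint_def)

lemma selfadjoint_complex_linear: "selfadjoint T \<Longrightarrow> T (c *\<^sub>C v) = c *\<^sub>C T v"
  by (simp add: selfadjoint_def bounded_ops_def)

text \<open>For a complex-linear operator the imaginary parts are real parts with \<open>w\<close> replaced by \<open>\<i> w\<close>; so
  all later arguments can be made with the real-valued form.\<close>

lemma selfadjoint_iff_re_inner:
  "selfadjoint T \<longleftrightarrow> T \<in> bounded_ops \<and> (\<forall>v w. T v \<bullet>\<^sub>R w = v \<bullet>\<^sub>R T w)"
proof
  assume T: "T \<in> bounded_ops \<and> (\<forall>v w. T v \<bullet>\<^sub>R w = v \<bullet>\<^sub>R T w)"
  have lin: "T (\<i> *\<^sub>C v) = \<i> *\<^sub>C T v" for v
    using T by (simp add: bounded_ops_def)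
  have "Im (cinner (T v) w) = Im (cinner v (T w))" for v w
    by (metis Im_cinner T lin)
  then show "selfadjoint T"
    using T by (simp add: selfadjoint_iff complex_eq_iff re_inner_def)
qed (auto simp: selfadjoint_re_inner selfadjoint_def)

lemma selfadjoint_id: "selfadjoint id_blinfun"
  by (simp add: selfadjoint_iff)

lemma selfadjoint_0: "selfadjoint 0"
proof -
  have "cinner 0 w = 0" "cinner w 0 = 0" for w :: 'a
    using cinner_scaleR_left[of 0 0 w] cinner_scaleR_right[of w 0 0] by simp_all
  then show ?thesis by (simp add: selfadjoint_iff)
qed

lemma selfadjoint_add: "selfadjoint S \<Longrightarrow> selfadjoint T \<Longrightarrow> selfadjoint (S + T)"
  by (simp add: selfadjoint_iff blinfun.bilinear_simps cinner_add_left cinner_add_right)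

lemma selfadjoint_scaleR: "selfadjoint T \<Longrightarrow> selfadjoint (r *\<^sub>R T)"
  by (simp add: selfadjoint_iff blinfun.bilinear_simps cinner_scaleR_left cinner_scaleR_right)

lemma selfadjoint_diff: "selfadjoint S \<Longrightarrow> selfadjoint T \<Longrightarrow> selfadjoint (S - T)"
  by (metis selfadjoint_add selfadjoint_scaleR scaleR_minus1_left uminus_add_conv_diff add.commute)

lemma selfadjoint_sum: "(\<And>i. i \<in> I \<Longrightarrow> selfadjoint (T i)) \<Longrightarrow> selfadjoint (\<Sum>i\<in>I. T i)"
  by (induction I rule: infinite_finite_induct) (auto intro: selfadjoint_0 selfadjoint_add)

definition commuting :: "('a::real_normed_vector \<Rightarrow>\<^sub>L 'a) \<Rightarrow> ('a \<Rightarrow>\<^sub>L 'a) \<Rightarrow> bool" where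
  "commuting S T \<longleftrightarrow> (\<forall>v. S (T v) = T (S v))"

lemma commuting_apply: "commuting S T \<Longrightarrow> S (T v) = T (S v)"
  by (simp add: commuting_def)

lemma commuting_sym: "commuting S T \<Longrightarrow> commuting T S"
  by (simp add: commuting_def)

lemma selfadjoint_compose: "selfadjoint S \<Longrightarrow> selfadjoint T \<Longrightarrow> commuting S T \<Longrightarrow> selfadjoint (S o\<^sub>L T)"
  by (simp add: selfadjoint_iff commuting_def)

text \<open>Kernel projections and the infinite sum of positive parts both arise as strong limits; this
  packages a pointwise limit as a bounded operator.\<close>

lemma pointwise_limit_operator:
  fixes T :: "'i \<Rightarrow> 'a::real_normed_vector \<Rightarrow>\<^sub>L 'a"
  assumes "F \<noteq> bot" and conv: "\<And>v. \<exists>w. ((\<lambda>i. T i v) \<longlongrightarrow> w) F"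
    and bound: "\<forall>\<^sub>F i in F. \<forall>v. norm (T i v) \<le> K * norm v"
  obtains S :: "'a \<Rightarrow>\<^sub>L 'a" where "\<And>v. ((\<lambda>i. T i v) \<longlongrightarrow> S v) F" "\<And>v. norm (S v) \<le> K * norm v"
proof -
  from conv obtain f where f: "\<And>v. ((\<lambda>i. T i v) \<longlongrightarrow> f v) F" by metis
  have f_bound: "norm (f v) \<le> K * norm v" for v
    using bound by (intro tendsto_upperbound[OF tendsto_norm[OF f] _ \<open>F \<noteq> bot\<close>]) (auto elim: eventually_mono)
  have "bounded_linear f"
  proof (rule bounded_linear_intro)
    show "f (v + w) = f v + f w" for v w
      using tendsto_unique[OF \<open>F \<noteq> bot\<close> f[of "v + w"]] tendsto_add[OF f[of v] f[of w]]
      by (simp add: blinfun.bilinear_simps)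
    show "f (r *\<^sub>R v) = r *\<^sub>R f v" for r v
      using tendsto_unique[OF \<open>F \<noteq> bot\<close> f[of "r *\<^sub>R v"]] tendsto_scaleR[OF tendsto_const f[of v], of r]
      by (simp add: blinfun.bilinear_simps)
    show "norm (f v) \<le> norm v * K" for v
      using f_bound[of v] by (simp add: mult.commute)
  qed
  then show ?thesis
    using that[of "Blinfun f"] f f_bound by (simp add: bounded_linear_Blinfun_apply)
qed

lemma selfadjoint_pointwise_limit:
  fixes T :: "'i \<Rightarrow> 'a::complex_hilbert_space \<Rightarrow>\<^sub>L 'a" and S :: "'a \<Rightarrow>\<^sub>L 'a"
  assumes "F \<noteq> bot" and lim: "\<And>v. ((\<lambda>i. T i v) \<longlongrightarrow> S v) F"
    and sa: "\<forall>\<^sub>F i in F. selfadjoint (T i)"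
  shows "selfadjoint S"
proof -
  have sym: "S v \<bullet>\<^sub>R w = v \<bullet>\<^sub>R S w" for v w
  proof (rule tendsto_unique[OF \<open>F \<noteq> bot\<close>])
    show "((\<lambda>i. T i v \<bullet>\<^sub>R w) \<longlongrightarrow> S v \<bullet>\<^sub>R w) F"
      by (intro re_inner.tendsto lim tendsto_const)
    show "((\<lambda>i. T i v \<bullet>\<^sub>R w) \<longlongrightarrow> v \<bullet>\<^sub>R S w) F"
    proof (rule Lim_transform_eventually)
      show "((\<lambda>i. v \<bullet>\<^sub>R T i w) \<longlongrightarrow> v \<bullet>\<^sub>R S w) F"
        by (intro re_inner.tendsto lim tendsto_const)
      show "\<forall>\<^sub>F i in F. v \<bullet>\<^sub>R T i w = T i v \<bullet>\<^sub>R w"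
        using sa by (rule eventually_mono) (simp add: selfadjoint_re_inner)
    qed
  qed
  \<comment> \<open>The complex scalar is moved to the other side of the form, which is continuous over the reals.\<close>
  have "S (c *\<^sub>C v) = c *\<^sub>C S v" for c v
  proof -
    have "(S (c *\<^sub>C v) - c *\<^sub>C S v) \<bullet>\<^sub>R w = 0" for w
    proof -
      have "(c *\<^sub>C x) \<bullet>\<^sub>R y = x \<bullet>\<^sub>R (cnj c *\<^sub>C y)" for x y
        by (simp add: re_inner_def cinner_scaleC_left cinner_scaleC_right)
      note move = this
      have "((\<lambda>i. T i (c *\<^sub>C v) \<bullet>\<^sub>R w) \<longlongrightarrow> S (c *\<^sub>C v) \<bullet>\<^sub>R w) F"
        by (intro re_inner.tendsto lim tendsto_const)
      moreover have "((\<lambda>i. T i (c *\<^sub>C v) \<bullet>\<^sub>R w) \<longlongrightarrow> S v \<bullet>\<^sub>R (cnj c *\<^sub>C w)) F"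
      proof (rule Lim_transform_eventually)
        show "((\<lambda>i. T i v \<bullet>\<^sub>R (cnj c *\<^sub>C w)) \<longlongrightarrow> S v \<bullet>\<^sub>R (cnj c *\<^sub>C w)) F"
          by (intro re_inner.tendsto lim tendsto_const)
        show "\<forall>\<^sub>F i in F. T i v \<bullet>\<^sub>R (cnj c *\<^sub>C w) = T i (c *\<^sub>C v) \<bullet>\<^sub>R w"
          using sa by (rule eventually_mono) (simp add: selfadjoint_complex_linear move)
      qed
      ultimately have "S (c *\<^sub>C v) \<bullet>\<^sub>R w = S v \<bullet>\<^sub>R (cnj c *\<^sub>C w)"
        by (rule tendsto_unique[OF \<open>F \<noteq> bot\<close>])
      then show ?thesis by (simp add: re_inner_simps move)
    qed
    then show ?thesis using eq_0_if_re_inner_all by fastforce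
  qed
  with sym show ?thesis by (simp add: selfadjoint_iff_re_inner bounded_ops_def)
qed

text \<open>Polarisation: \<open>4 \<langle>T v, w\<rangle>\<close> is the difference of the form at \<open>v + w\<close> and at \<open>v - w\<close>, and the
  parallelogram law bounds that difference.\<close>

lemma norm_le_if_form_le:
  assumes sa: "selfadjoint T" and form: "\<And>v. \<bar>T v \<bullet>\<^sub>R v\<bar> \<le> K * (norm v)\<^sup>2"
  shows "norm (T v) \<le> K * norm v"
proof (cases "T v = 0 \<or> v = 0")
  case True
  have "0 \<le> K * norm v"
  proof (cases "v = 0")
    case False
    have "0 \<le> K * (norm v)\<^sup>2" using form[of v] by linarith
    with False show ?thesis by (simp add: zero_le_mult_iff)
  qed simp
  with True show ?thesis by (auto simp: blinfun.bilinear_simps)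
next
  case False
  then have pos: "norm v > 0" "norm (T v) > 0" by auto
  \<comment> \<open>The second vector points along \<open>T v\<close> and has the length of \<open>v\<close>.\<close>
  define w where "w = (norm v / norm (T v)) *\<^sub>R T v"
  have norm_w: "norm w = norm v" using pos by (simp add: w_def)
  have "4 * (T v \<bullet>\<^sub>R w) = T (v + w) \<bullet>\<^sub>R (v + w) - T (v - w) \<bullet>\<^sub>R (v - w)"
    using selfadjoint_re_inner[OF sa, of w v]
    by (simp add: blinfun.bilinear_simps re_inner_simps re_inner_commute[of w "T v"])
  also have "\<dots> \<le> K * (norm (v + w))\<^sup>2 + K * (norm (v - w))\<^sup>2"
    using form[of "v + w"] form[of "v - w"] by linarith
  also have "\<dots> = 4 * K * (norm v)\<^sup>2"
    by (simp add: norm_add_square norm_diff_square norm_w algebra_simps)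
  also have "T v \<bullet>\<^sub>R w = norm v * norm (T v)"
    using pos by (simp add: w_def re_inner_simps re_inner_self power2_eq_square)
  finally have "norm v * norm (T v) \<le> norm v * (K * norm v)"
    by (simp add: power2_eq_square algebra_simps)
  then show ?thesis using pos by simp
qed

section \<open>Norm-closed algebras and square roots\<close>

text \<open>The identity operator is left out of the closure conditions, because a von Neumann algebra acting
  on a larger space does not contain it.\<close>

definition closed_algebra :: "('a::real_normed_vector \<Rightarrow>\<^sub>L 'a) set \<Rightarrow> bool" where
  "closed_algebra B \<longleftrightarrow> closed B \<and> 0 \<in> B \<and> (\<forall>S\<in>B. \<forall>T\<in>B. S + T \<in> B) \<and>
     (\<forall>r. \<forall>T\<in>B. r *\<^sub>R T \<in> B) \<and> (\<forall>S\<in>B. \<forall>T\<in>B. S o\<^sub>L T \<in> B)"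

lemma closed_algebraD:
  assumes "closed_algebra B"
  shows "closed B" "0 \<in> B" "S \<in> B \<Longrightarrow> T \<in> B \<Longrightarrow> S + T \<in> B" "T \<in> B \<Longrightarrow> r *\<^sub>R T \<in> B"
    "S \<in> B \<Longrightarrow> T \<in> B \<Longrightarrow> S o\<^sub>L T \<in> B" "S \<in> B \<Longrightarrow> T \<in> B \<Longrightarrow> S - T \<in> B"
proof -
  show "S - T \<in> B" if "S \<in> B" "T \<in> B"
  proof -
    have "S + (-1) *\<^sub>R T \<in> B" using assms that unfolding closed_algebra_def by blast
    then show ?thesis by simp
  qed
qed (use assms in \<open>auto simp: closed_algebra_def\<close>)

text \<open>Commutants are closed algebras too, so a statement that some operator lies in every closed algebra
  containing \<open>a\<close> also says that it commutes with whatever commutes with \<open>a\<close>.\<close>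

lemma closed_algebra_commutant: "closed_algebra {S. commuting S T}"
proof -
  have "closed {S. commuting S T}"
    unfolding commuting_def
    by (intro closed_Collect_all closed_Collect_eq continuous_intros)
  then show ?thesis
    by (auto simp: closed_algebra_def commuting_def blinfun.bilinear_simps)
qed

lemma closed_algebra_cstar: "cstar_subalgebra A \<Longrightarrow> closed_algebra A"
proof -
  assume A: "cstar_subalgebra A"
  have "r *\<^sub>R T \<in> A" if "T \<in> A" for r T
  proof -
    from A that obtain S where "S \<in> A" "\<forall>v. S v = complex_of_real r *\<^sub>C T v"
      unfolding cstar_subalgebra_def by blast
    moreover from this have "S = r *\<^sub>R T"
      by (intro blinfun_eqI) (simp add: blinfun.bilinear_simps scaleR_scaleC)
    ultimately show ?thesis by simp
  qed
  then show ?thesis using A by (auto simp: closed_algebra_def cstar_subalgebra_def)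
qed

text \<open>The iteration below for the scalar 0 in place of \<open>a\<close>; it bounds the operator iteration and its
  increments in norm.\<close>

fun sqrt_scalar :: "nat \<Rightarrow> real" where
  "sqrt_scalar 0 = 0"
| "sqrt_scalar (Suc n) = (1 + (sqrt_scalar n)\<^sup>2) / 2"

lemma sqrt_scalar_bounds: "0 \<le> sqrt_scalar n \<and> sqrt_scalar n \<le> 1"
proof (induction n)
  case (Suc n)
  then have "(sqrt_scalar n)\<^sup>2 \<le> 1" by (simp add: power_le_one)
  then show ?case by simp
qed simp

lemma sqrt_scalar_mono: "sqrt_scalar n \<le> sqrt_scalar (Suc n)"
proof -
  have "0 \<le> (1 - sqrt_scalar n)\<^sup>2" by simp
  then show ?thesis by (simp add: power2_eq_square algebra_simps)
qed

lemma sqrt_scalar_tendsto: "sqrt_scalar \<longlonglongrightarrow> 1"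
proof -
  have "convergent sqrt_scalar"
    by (intro Bseq_monoseq_convergent BseqI'[of _ 1] incseq_imp_monoseq incseq_SucI sqrt_scalar_mono)
       (use sqrt_scalar_bounds in auto)
  then obtain L where L: "sqrt_scalar \<longlonglongrightarrow> L" by (auto simp: convergent_def)
  have "(\<lambda>n. sqrt_scalar (Suc n)) \<longlonglongrightarrow> (1 + L\<^sup>2) / 2"
    unfolding sqrt_scalar.simps by (intro tendsto_intros L) simp
  with LIMSEQ_Suc[OF L] have "L = (1 + L\<^sup>2) / 2" by (rule LIMSEQ_unique)
  then have "(L - 1)\<^sup>2 = 0" by (simp add: power2_eq_square algebra_simps)
  with L show ?thesis by simp
qed

text \<open>A fixed point \<open>y\<close> satisfies \<open>(1 - y)\<^sup>2 = a\<close>.\<close>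

fun sqrt_iter :: "('a::real_normed_vector \<Rightarrow>\<^sub>L 'a) \<Rightarrow> nat \<Rightarrow> 'a \<Rightarrow>\<^sub>L 'a" where
  "sqrt_iter a 0 = 0"
| "sqrt_iter a (Suc n) = (1/2) *\<^sub>R (id_blinfun - a + (sqrt_iter a n o\<^sub>L sqrt_iter a n))"

lemma sqrt_iter_commuting: "commuting a T \<Longrightarrow> commuting (sqrt_iter a n) T"
  by (induction n) (simp_all add: commuting_def blinfun.bilinear_simps)

lemma sqrt_iter_commuting_self: "commuting (sqrt_iter a m) (sqrt_iter a n)"
  by (rule sqrt_iter_commuting, rule commuting_sym, rule sqrt_iter_commuting) (simp add: commuting_def)

lemma sqrt_iter_norm:
  assumes "norm (id_blinfun - a) \<le> 1"
  shows "norm (sqrt_iter a n) \<le> sqrt_scalar n"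
proof (induction n)
  case (Suc n)
  have "norm ((sqrt_iter a n o\<^sub>L sqrt_iter a n)) \<le> (sqrt_scalar n)\<^sup>2"
    by (rule order_trans[OF norm_blinfun_compose])
       (simp add: power2_eq_square mult_mono Suc sqrt_scalar_bounds)
  then have "norm (id_blinfun - a + (sqrt_iter a n o\<^sub>L sqrt_iter a n)) \<le> 1 + (sqrt_scalar n)\<^sup>2"
    using assms norm_triangle_le[OF add_mono] by blast
  then show ?case by simp
qed simp

text \<open>Consecutive increments are related by \<open>2 (y\<^bsub>n+2\<^esub> - y\<^bsub>n+1\<^esub>) = (y\<^bsub>n+1\<^esub> - y\<^sub>n) (y\<^bsub>n+1\<^esub> + y\<^sub>n)\<close>,
  since the iterates commute, and the scalar iteration obeys the same relation.\<close>

lemma sqrt_iter_step: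
  assumes "norm (id_blinfun - a) \<le> 1"
  shows "norm (sqrt_iter a (Suc n) - sqrt_iter a n) \<le> sqrt_scalar (Suc n) - sqrt_scalar n"
proof (induction n)
  case 0
  then show ?case using assms by simp
next
  case (Suc n)
  define y y' where "y = sqrt_iter a n" and "y' = sqrt_iter a (Suc n)"
  define t t' where "t = sqrt_scalar n" and "t' = sqrt_scalar (Suc n)"
  have comm: "y (y' v) = y' (y v)" for v
    using sqrt_iter_commuting_self unfolding y_def y'_def commuting_def by blast
  have "sqrt_iter a (Suc (Suc n)) = (1/2) *\<^sub>R (id_blinfun - a + (y' o\<^sub>L y'))"
    and "sqrt_iter a (Suc n) = (1/2) *\<^sub>R (id_blinfun - a + (y o\<^sub>L y))"
    by (simp_all only: sqrt_iter.simps y_def y'_def)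
  then have "sqrt_iter a (Suc (Suc n)) - sqrt_iter a (Suc n)
      = (1/2) *\<^sub>R (id_blinfun - a + (y' o\<^sub>L y')) - (1/2) *\<^sub>R (id_blinfun - a + (y o\<^sub>L y))"
    by (rule arg_cong2[where f = minus])
  also have "\<dots> = (1/2) *\<^sub>R ((y' - y) o\<^sub>L (y' + y))"
    by (intro blinfun_eqI) (simp add: blinfun.bilinear_simps algebra_simps comm)
  finally have "norm (sqrt_iter a (Suc (Suc n)) - sqrt_iter a (Suc n))
      = (1/2) * norm ((y' - y) o\<^sub>L (y' + y))" by simp
  also have "\<dots> \<le> (1/2) * (norm (y' - y) * (norm y' + norm y))"
    by (intro mult_left_mono order_trans[OF norm_blinfun_compose]) (simp_all add: norm_triangle_ineq mult_left_mono)
  also have "\<dots> \<le> (1/2) * ((t' - t) * (t' + t))"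
    using Suc sqrt_iter_norm[OF assms, of n] sqrt_iter_norm[OF assms, of "Suc n"] sqrt_scalar_mono[of n]
    unfolding y_def y'_def t_def t'_def
    by (intro mult_left_mono mult_mono add_mono) (simp_all del: sqrt_iter.simps sqrt_scalar.simps)
  also have "\<dots> = sqrt_scalar (Suc (Suc n)) - sqrt_scalar (Suc n)"
    unfolding sqrt_scalar.simps(2)[of "Suc n"] sqrt_scalar.simps(2)[of n] t_def[symmetric]
    by (simp add: t_def t'_def power2_eq_square field_simps)
  finally show ?case .
qed

lemma sqrt_iter_convergent:
  fixes a :: "'a::banach \<Rightarrow>\<^sub>L 'a"
  assumes "norm (id_blinfun - a) \<le> 1"
  shows "convergent (sqrt_iter a)"
proof -
  have "summable (\<lambda>n. sqrt_scalar (Suc n) - sqrt_scalar n)"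
    by (rule telescope_summable[OF sqrt_scalar_tendsto])
  then have "summable (\<lambda>n. sqrt_iter a (Suc n) - sqrt_iter a n)"
    by (rule summable_comparison_test'[of _ 0]) (rule sqrt_iter_step[OF assms])
  then have "convergent (\<lambda>n. \<Sum>k<n. sqrt_iter a (Suc k) - sqrt_iter a k)"
    by (simp add: summable_iff_convergent)
  then show ?thesis unfolding sum_lessThan_telescope by simp
qed

text \<open>\<open>sqrt_iter a n\<close> is a polynomial in \<open>a\<close> with constant term \<open>sqrt_scalar n\<close>. As these constant terms
  tend to 1, the square root \<open>1 - lim sqrt_iter a n\<close> is a limit of polynomials without constant term.\<close>

lemma sqrt_iter_in_algebra:
  assumes "closed_algebra B" "a \<in> B"
  shows "sqrt_scalar n *\<^sub>R id_blinfun - sqrt_iter a n \<in> B"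
proof (induction n)
  case (Suc n)
  define d where "d = sqrt_scalar n *\<^sub>R id_blinfun - sqrt_iter a n"
  have "sqrt_scalar (Suc n) *\<^sub>R id_blinfun - sqrt_iter a (Suc n)
      = (1/2) *\<^sub>R ((1 + (sqrt_scalar n)\<^sup>2) *\<^sub>R id_blinfun
          - (id_blinfun - a + (sqrt_iter a n o\<^sub>L sqrt_iter a n)))"
    by (simp add: scaleR_diff_right)
  also have "(1 + (sqrt_scalar n)\<^sup>2) *\<^sub>R id_blinfun
      - (id_blinfun - a + (sqrt_iter a n o\<^sub>L sqrt_iter a n))
      = a + (sqrt_scalar n *\<^sub>R d + sqrt_scalar n *\<^sub>R d) - (d o\<^sub>L d)"
    by (intro blinfun_eqI)
       (simp add: d_def blinfun.bilinear_simps algebra_simps power2_eq_square)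
  finally have "sqrt_scalar (Suc n) *\<^sub>R id_blinfun - sqrt_iter a (Suc n)
      = (1/2) *\<^sub>R (a + (sqrt_scalar n *\<^sub>R d + sqrt_scalar n *\<^sub>R d) - (d o\<^sub>L d))" .
  moreover have "d \<in> B" using Suc by (simp add: d_def)
  ultimately show ?case
    using assms by (auto intro!: closed_algebraD[OF assms(1)])
qed (simp add: closed_algebraD[OF assms(1)])

text \<open>The root is \<open>1 - y\<close> for the limit \<open>y\<close> of the iteration. As \<open>y\<close> is a contraction, \<open>1 - y\<close> is positive,
  and equality in \<open>\<langle>y v, v\<rangle> \<le> \<parallel>v\<parallel>\<^sup>2\<close> forces \<open>y v = v\<close>.\<close>

lemma positive_square_root:
  fixes a :: "'a::complex_hilbert_space \<Rightarrow>\<^sub>L 'a"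
  assumes sa: "selfadjoint a" and norm: "norm (id_blinfun - a) \<le> 1"
  obtains b where "selfadjoint b" "\<And>v. b (b v) = a v" "\<And>v. 0 \<le> b v \<bullet>\<^sub>R v"
    "\<And>v. b v \<bullet>\<^sub>R v = 0 \<Longrightarrow> b v = 0" "\<And>B. closed_algebra B \<Longrightarrow> a \<in> B \<Longrightarrow> b \<in> B"
proof -
  from sqrt_iter_convergent[OF norm] obtain y where y: "sqrt_iter a \<longlonglongrightarrow> y"
    by (auto simp: convergent_def)
  have y_app: "(\<lambda>n. sqrt_iter a n v) \<longlonglongrightarrow> y v" for v
    by (intro blinfun.tendsto y tendsto_const)
  have y_norm: "norm y \<le> 1"
    using sqrt_iter_norm[OF norm] sqrt_scalar_bounds
    by (intro LIMSEQ_le_const2[OF tendsto_norm[OF y]]) (meson order_trans)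
  have "(\<lambda>n. sqrt_iter a (Suc n)) \<longlonglongrightarrow> (1/2) *\<^sub>R (id_blinfun - a + (y o\<^sub>L y))"
    unfolding sqrt_iter.simps
    by (intro tendsto_intros bounded_bilinear.tendsto[OF bounded_bilinear_blinfun_compose] y)
  with LIMSEQ_Suc[OF y] have y_eq: "y = (1/2) *\<^sub>R (id_blinfun - a + (y o\<^sub>L y))"
    by (rule LIMSEQ_unique)
  have "selfadjoint (sqrt_iter a n)" for n
    by (induction n)
       (auto intro!: selfadjoint_0 selfadjoint_scaleR selfadjoint_add selfadjoint_diff selfadjoint_id sa
          selfadjoint_compose sqrt_iter_commuting_self)
  then have y_sa: "selfadjoint y"
    by (intro selfadjoint_pointwise_limit[OF _ y_app]) auto
  define b where "b = id_blinfun - y"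
  have b_sa: "selfadjoint b"
    by (simp add: b_def selfadjoint_diff selfadjoint_id y_sa)
  have b_square: "b (b v) = a v" for v
  proof -
    have "2 *\<^sub>R y v = v - a v + y (y v)"
      using arg_cong[OF y_eq, of "\<lambda>T. 2 *\<^sub>R blinfun_apply T v"]
      by (simp add: blinfun.bilinear_simps)
    then show ?thesis by (simp add: b_def blinfun.bilinear_simps algebra_simps scaleR_2)
  qed
  have y_le: "norm (y v) \<le> norm v" for v
    using norm_blinfun[of y v] mult_right_mono[OF y_norm, of "norm v"] by simp
  have b_form: "b v \<bullet>\<^sub>R v = (norm v)\<^sup>2 - y v \<bullet>\<^sub>R v" for v
    by (simp add: b_def blinfun.bilinear_simps re_inner_simps re_inner_self)
  have b_pos: "0 \<le> b v \<bullet>\<^sub>R v" for v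
  proof -
    have "y v \<bullet>\<^sub>R v \<le> norm v * norm v"
      using re_inner_le_norm[of "y v" v] mult_right_mono[OF y_le[of v], of "norm v"] by simp
    then show ?thesis by (simp add: b_form power2_eq_square)
  qed
  have b_null: "b v = 0" if "b v \<bullet>\<^sub>R v = 0" for v
  proof -
    have "(norm (v - y v))\<^sup>2 = (norm v)\<^sup>2 - 2 * (y v \<bullet>\<^sub>R v) + (norm (y v))\<^sup>2"
      by (simp add: norm_diff_square re_inner_commute)
    also have "\<dots> \<le> 0"
      using that power_mono[OF y_le[of v], of 2] by (simp add: b_form)
    finally show ?thesis by (simp add: b_def blinfun.bilinear_simps)
  qed
  have "b \<in> B" if B: "closed_algebra B" "a \<in> B" for B
  proof (rule closed_sequentially)
    show "closed B" using B by (simp add: closed_algebraD)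
    show "sqrt_scalar n *\<^sub>R id_blinfun - sqrt_iter a n \<in> B" for n
      by (rule sqrt_iter_in_algebra[OF B])
    show "(\<lambda>n. sqrt_scalar n *\<^sub>R id_blinfun - sqrt_iter a n) \<longlonglongrightarrow> b"
      using tendsto_diff[OF tendsto_scaleR[OF sqrt_scalar_tendsto tendsto_const] y]
      by (simp add: b_def)
  qed
  then show ?thesis using that b_sa b_square b_pos b_null by blast
qed

section \<open>Projections\<close>

lemma projection_idem: "projection_op P \<Longrightarrow> P (P v) = P v"
  by (metis blinfun_apply_blinfun_compose projection_op_def)

lemma projection_selfadjoint: "projection_op P \<Longrightarrow> selfadjoint P"
  by (simp add: projection_op_def)

lemma projection_opI: "selfadjoint P \<Longrightarrow> (\<And>v. P (P v) = P v) \<Longrightarrow> projection_op P"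
  by (auto simp: projection_op_def intro: blinfun_eqI)

lemma projection_form: "projection_op P \<Longrightarrow> P v \<bullet>\<^sub>R v = (norm (P v))\<^sup>2"
  by (metis projection_idem projection_selfadjoint re_inner_self selfadjoint_re_inner)

lemma projection_pythagoras:
  assumes "projection_op P" shows "(norm v)\<^sup>2 = (norm (P v))\<^sup>2 + (norm (v - P v))\<^sup>2"
  using norm_diff_square[of v "P v"] projection_form[OF assms, of v] re_inner_commute[of v "P v"]
  by linarith

lemma projection_complement: "projection_op P \<Longrightarrow> projection_op (id_blinfun - P)"
  by (rule projection_opI)
     (simp_all add: selfadjoint_diff selfadjoint_id projection_selfadjoint
       blinfun.bilinear_simps projection_idem)

lemma selfadjoint_form_real: "selfadjoint T \<Longrightarrow> cinner (T v) v \<in> \<real>\<^sub>\<ge>\<^sub>0 \<longleftrightarrow> 0 \<le> T v \<bullet>\<^sub>R v"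
proof -
  assume "selfadjoint T"
  then have "cinner (T v) v = cnj (cinner (T v) v)"
    by (metis cinner_commute selfadjoint_iff)
  then have "Im (cinner (T v) v) = 0" by (simp add: complex_eq_iff)
  then show ?thesis by (simp add: complex_nonneg_Reals_iff re_inner_def)
qed

lemma op_le_selfadjoint:
  "selfadjoint S \<Longrightarrow> selfadjoint T \<Longrightarrow> op_le S T \<longleftrightarrow> (\<forall>v. S v \<bullet>\<^sub>R v \<le> T v \<bullet>\<^sub>R v)"
  using selfadjoint_diff[of T S]
  by (simp add: op_le_def positive_op_def selfadjoint_form_real selfadjoint_def[of "T - S"])
     (simp add: blinfun.bilinear_simps re_inner_simps)

text \<open>The second equation is the adjoint of the first.\<close>

lemma projection_absorb:
  assumes P: "projection_op P" and Q: "projection_op Q" and range: "\<And>v. P v = v \<Longrightarrow> Q v = v"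
  shows "Q (P v) = P v" "P (Q v) = P v"
proof -
  show QP: "Q (P v) = P v" for v
    by (rule range) (simp add: projection_idem P)
  have "(P (Q v) - P v) \<bullet>\<^sub>R w = 0" for w
    using QP[of w] by (simp add: re_inner_simps selfadjoint_re_inner projection_selfadjoint P Q)
  then show "P (Q v) = P v" using eq_0_if_re_inner_all by fastforce
qed

lemma projection_le_iff_range:
  assumes P: "projection_op P" and Q: "projection_op Q"
  shows "op_le P Q \<longleftrightarrow> (\<forall>v. P v = v \<longrightarrow> Q v = v)"
proof
  assume le: "op_le P Q"
  show "\<forall>v. P v = v \<longrightarrow> Q v = v"
  proof (intro allI impI)
    fix v assume "P v = v"
    then have "(norm v)\<^sup>2 \<le> (norm (Q v))\<^sup>2"
      using le op_le_selfadjoint[of P Q] projection_form[OF P, of v] projection_form[OF Q, of v]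
      by (metis P Q projection_selfadjoint)
    then have "(norm (v - Q v))\<^sup>2 \<le> 0"
      using projection_pythagoras[OF Q, of v] by linarith
    then show "Q v = v" by simp
  qed
next
  assume "\<forall>v. P v = v \<longrightarrow> Q v = v"
  then have QP: "P (Q v) = P v" for v
    using projection_absorb[OF P Q] by blast
  have "(norm (P v))\<^sup>2 \<le> (norm (Q v))\<^sup>2" for v
    using projection_pythagoras[OF P, of "Q v"] by (simp add: QP)
  then show "op_le P Q"
    using op_le_selfadjoint[of P Q] P Q by (simp add: projection_form projection_selfadjoint)
qed

lemma projection_eqI:
  assumes P: "projection_op P" and Q: "projection_op Q" and range: "\<And>v. P v = v \<longleftrightarrow> Q v = v"
  shows "P = Q"
  by (intro blinfun_eqI) (metis P Q projection_absorb range)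

lemma op_le_antisym_projection:
  "projection_op P \<Longrightarrow> projection_op Q \<Longrightarrow> op_le P Q \<Longrightarrow> op_le Q P \<Longrightarrow> P = Q"
  by (rule projection_eqI) (auto simp: projection_le_iff_range)

fun op_power :: "('a::real_normed_vector \<Rightarrow>\<^sub>L 'a) \<Rightarrow> nat \<Rightarrow> 'a \<Rightarrow>\<^sub>L 'a" where
  "op_power R 0 = id_blinfun"
| "op_power R (Suc n) = R o\<^sub>L op_power R n"

lemma op_power_add:
  fixes R :: "'a::real_normed_vector \<Rightarrow>\<^sub>L 'a"
  shows "op_power R (m + n) v = op_power R m (op_power R n v)"
  by (induction m) auto

lemma op_power_commuting: "commuting R T \<Longrightarrow> commuting (op_power R n) T"
  by (induction n) (simp_all add: commuting_def)

lemma op_power_selfadjoint: "selfadjoint R \<Longrightarrow> selfadjoint (op_power R n)"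
  by (induction n)
     (auto intro!: selfadjoint_id selfadjoint_compose commuting_sym[OF op_power_commuting] simp: commuting_def[of R R])

lemma op_power_fixed:
  fixes R :: "'a::real_normed_vector \<Rightarrow>\<^sub>L 'a"
  shows "R v = v \<Longrightarrow> op_power R n v = v"
  by (induction n) simp_all

text \<open>A self-adjoint contraction \<open>R\<close> has \<open>\<langle>R\<^sup>m v, R\<^sup>n v\<rangle> = \<parallel>R\<^bsup>(m+n)/2\<^esup> v\<parallel>\<^sup>2\<close> for \<open>m + n\<close> even, and
  \<open>\<parallel>R\<^sup>n v\<parallel>\<close> decreases with \<open>n\<close>; hence the even powers form a pointwise Cauchy sequence.\<close>

lemma even_powers_Cauchy:
  fixes R :: "'a::complex_hilbert_space \<Rightarrow>\<^sub>L 'a"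
  assumes sa: "selfadjoint R" and contr: "\<And>v. norm (R v) \<le> norm v"
  shows "Cauchy (\<lambda>n. op_power R (2 * n) v)"
proof -
  define g where "g n = (norm (op_power R n v))\<^sup>2" for n
  have "decseq g"
    unfolding g_def by (intro decseq_SucI power_mono) (simp_all add: contr)
  moreover have "0 \<le> g n" for n by (simp add: g_def)
  ultimately obtain L where "g \<longlonglongrightarrow> L"
    using decseq_convergent by blast
  have form: "op_power R i v \<bullet>\<^sub>R op_power R j v = v \<bullet>\<^sub>R op_power R (i + j) v" for i j
    by (simp add: op_power_add selfadjoint_re_inner[OF op_power_selfadjoint[OF sa]])
  have dist: "(norm (op_power R (2 * m) v - op_power R (2 * n) v))\<^sup>2 = g (2 * m) + g (2 * n) - 2 * g (m + n)"
    for m n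
  proof -
    have "op_power R (2 * m) v \<bullet>\<^sub>R op_power R (2 * n) v = g (m + n)"
      unfolding form g_def re_inner_self[symmetric] by (simp add: mult_2 add_ac)
    then show ?thesis by (simp add: norm_diff_square g_def)
  qed
  show ?thesis
  proof (rule CauchyI)
    fix \<epsilon> :: real assume "\<epsilon> > 0"
    then have "\<epsilon>\<^sup>2 / 4 > 0" by simp
    with \<open>g \<longlonglongrightarrow> L\<close> obtain N where N: "\<And>n. n \<ge> N \<Longrightarrow> \<bar>g n - L\<bar> < \<epsilon>\<^sup>2 / 4"
      by (metis LIMSEQ_D real_norm_def)
    show "\<exists>N. \<forall>m\<ge>N. \<forall>n\<ge>N. norm (op_power R (2 * m) v - op_power R (2 * n) v) < \<epsilon>"
    proof (intro exI allI impI)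
      fix m n assume "N \<le> m" "N \<le> n"
      then have "\<bar>g (2 * m) - L\<bar> < \<epsilon>\<^sup>2 / 4" "\<bar>g (2 * n) - L\<bar> < \<epsilon>\<^sup>2 / 4" "\<bar>g (m + n) - L\<bar> < \<epsilon>\<^sup>2 / 4"
        by (rule_tac N, linarith)+
      then have "(norm (op_power R (2 * m) v - op_power R (2 * n) v))\<^sup>2 < \<epsilon>\<^sup>2"
        unfolding dist by linarith
      then show "norm (op_power R (2 * m) v - op_power R (2 * n) v) < \<epsilon>"
        using \<open>\<epsilon> > 0\<close> by (meson less_imp_le power_less_imp_less_base)
    qed
  qed
qed

text \<open>With \<open>R = 1 - p\<^sup>2 / K\<^sup>2\<close> for a large \<open>K\<close>, the vectors fixed by \<open>R\<close> are the kernel of \<open>p\<close>, and the even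
  powers of \<open>R\<close> converge pointwise to the projection onto them. Unlike an abstract orthogonal
  projection, this limit visibly commutes with whatever commutes with \<open>p\<close>.\<close>

lemma kernel_projection:
  fixes p :: "'a::complex_hilbert_space \<Rightarrow>\<^sub>L 'a"
  assumes sa: "selfadjoint p"
  obtains P where "projection_op P" "\<And>v. P v = v \<longleftrightarrow> p v = 0" "\<And>T. commuting p T \<Longrightarrow> commuting P T"
proof -
  define K where "K = norm p + 1"
  have K: "K > 0" by (simp add: K_def add_nonneg_pos)
  define R where "R = id_blinfun - (1 / K\<^sup>2) *\<^sub>R (p o\<^sub>L p)"
  have R_app: "R v = v - (1 / K\<^sup>2) *\<^sub>R p (p v)" for v
    by (simp add: R_def blinfun.bilinear_simps)
  have R_sa: "selfadjoint R"
    unfolding R_def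
    by (intro selfadjoint_diff selfadjoint_id selfadjoint_scaleR selfadjoint_compose sa) (simp add: commuting_def)
  have pp: "p (p v) \<bullet>\<^sub>R v = (norm (p v))\<^sup>2" for v
    by (simp add: selfadjoint_re_inner[OF sa] re_inner_self)
  have R_form: "R v \<bullet>\<^sub>R v = (norm v)\<^sup>2 - (norm (p v))\<^sup>2 / K\<^sup>2" for v
    by (simp add: R_app re_inner_simps pp re_inner_self)
  have p_bound: "(norm (p v))\<^sup>2 / K\<^sup>2 \<le> (norm v)\<^sup>2" for v
  proof -
    have "norm (p v) \<le> K * norm v"
      by (rule order_trans[OF norm_blinfun]) (simp add: K_def mult_right_mono)
    then have "(norm (p v))\<^sup>2 \<le> (K * norm v)\<^sup>2" by (simp add: power_mono)
    then show ?thesis using K by (simp add: field_simps power_mult_distrib)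
  qed
  have contr: "norm (R v) \<le> norm v" for v
    using norm_le_if_form_le[OF R_sa, of 1 v] p_bound by (simp add: R_form)
  have fixed: "R v = v \<longleftrightarrow> p v = 0" for v
    using R_form[of v] K by (auto simp: R_app re_inner_self blinfun.bilinear_simps)
  define T where "T n = op_power R (2 * n)" for n
  have T_conv: "\<exists>w. (\<lambda>n. T n v) \<longlonglongrightarrow> w" for v
    using even_powers_Cauchy[OF R_sa contr, of v] by (simp add: T_def Cauchy_convergent_iff convergent_def)
  have "norm (op_power R n v) \<le> norm v" for n v
    by (induction n) (auto intro: order_trans[OF contr])
  then have T_bound: "\<forall>\<^sub>F n in sequentially. \<forall>v. norm (T n v) \<le> 1 * norm v"
    by (simp add: T_def)
  obtain P :: "'a \<Rightarrow>\<^sub>L 'a" where P: "\<And>v. (\<lambda>n. T n v) \<longlonglongrightarrow> P v"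
    by (rule pointwise_limit_operator[OF sequentially_bot T_conv T_bound]) (erule that)
  have P_sa: "selfadjoint P"
    by (rule selfadjoint_pointwise_limit[OF sequentially_bot P]) (simp add: T_def op_power_selfadjoint R_sa)
  have P_fix: "P v = v" if "R v = v" for v
    using P[of v] that by (simp add: T_def op_power_fixed LIMSEQ_const_iff)
  have R_P: "R (P v) = P v" for v
  proof -
    have "T (Suc n) v = R (R (T n v))" for n by (simp add: T_def)
    then have "(\<lambda>n. T (Suc n) v) \<longlonglongrightarrow> R (R (P v))"
      by (simp add: blinfun.tendsto P)
    with LIMSEQ_Suc[OF P] have "R (R (P v)) = P v" by (metis LIMSEQ_unique)
    \<comment> \<open>On the difference of \<open>P v\<close> and \<open>R (P v)\<close> the positive operator \<open>R\<close> acts as \<open>-1\<close>.\<close>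
    define u where "u = P v - R (P v)"
    have "R u = - u" by (simp add: u_def blinfun.bilinear_simps \<open>R (R (P v)) = P v\<close>)
    then have "R u \<bullet>\<^sub>R u = - (norm u)\<^sup>2" by (simp add: re_inner_simps re_inner_self)
    then have "(norm u)\<^sup>2 \<le> 0" using R_form[of u] p_bound[of u] by linarith
    then show ?thesis by (simp add: u_def)
  qed
  show ?thesis
  proof
    show "projection_op P"
      by (intro projection_opI P_sa P_fix R_P)
    show "P v = v \<longleftrightarrow> p v = 0" for v
      using P_fix R_P fixed by metis
    show "commuting P S" if "commuting p S" for S
    proof -
      have "commuting (T n) S" for n
        unfolding T_def using that
        by (intro op_power_commuting) (simp add: commuting_def R_app blinfun.bilinear_simps)
      then have "(\<lambda>n. T n (S v)) \<longlonglongrightarrow> S (P v)" for v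
        unfolding commuting_def by (simp add: blinfun.tendsto P)
      then show ?thesis using P LIMSEQ_unique unfolding commuting_def by blast
    qed
  qed
qed

section \<open>Spectral projections\<close>

text \<open>Both inequalities together say that \<open>P\<close> is the spectral projection for \<open>(-\<infinity>, l]\<close>; strictness on the
  kernel assigns eigenvectors for \<open>l\<close> to the range.\<close>

definition spectral_projection ::
    "('a::complex_hilbert_space \<Rightarrow>\<^sub>L 'a) \<Rightarrow> real \<Rightarrow> ('a \<Rightarrow>\<^sub>L 'a) \<Rightarrow> bool" where
  "spectral_projection x l P \<longleftrightarrow> projection_op P \<and> commuting P x \<and>
     (\<forall>v. P v = v \<longrightarrow> x v \<bullet>\<^sub>R v \<le> l * (norm v)\<^sup>2) \<and>
     (\<forall>v. P v = 0 \<longrightarrow> v \<noteq> 0 \<longrightarrow> l * (norm v)\<^sup>2 < x v \<bullet>\<^sub>R v)"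

lemma spectral_projectionD:
  assumes "spectral_projection x l P"
  shows "projection_op P" "P (x v) = x (P v)" "P v = v \<Longrightarrow> x v \<bullet>\<^sub>R v \<le> l * (norm v)\<^sup>2"
    "P v = 0 \<Longrightarrow> v \<noteq> 0 \<Longrightarrow> l * (norm v)\<^sup>2 < x v \<bullet>\<^sub>R v" "P v = 0 \<Longrightarrow> l * (norm v)\<^sup>2 \<le> x v \<bullet>\<^sub>R v"
  using assms unfolding spectral_projection_def commuting_def
  by (auto simp: less_imp_le, cases "v = 0") (auto simp: re_inner_simps less_imp_le)

text \<open>The last property is what places positive parts in the algebra: \<open>(x - l) (1 - P)\<close> is a multiple of
  \<open>\<bar>x - l\<bar> + (x - l)\<close>.\<close>

lemma spectral_projection_exists:
  fixes x :: "'a::complex_hilbert_space \<Rightarrow>\<^sub>L 'a"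
  assumes sa: "selfadjoint x"
  obtains P where "spectral_projection x l P" "\<And>T. commuting x T \<Longrightarrow> commuting P T"
    "\<And>B. closed_algebra B \<Longrightarrow> x - l *\<^sub>R id_blinfun \<in> B \<Longrightarrow>
       (x - l *\<^sub>R id_blinfun) o\<^sub>L (id_blinfun - P) \<in> B"
proof -
  define z where "z = x - l *\<^sub>R id_blinfun"
  define c where "c = 1 / (norm z + 1)"
  have c: "c > 0" by (simp add: c_def add_nonneg_pos)
  define w where "w = c *\<^sub>R z"
  have w_app: "w v = c *\<^sub>R (x v - l *\<^sub>R v)" for v
    by (simp add: w_def z_def blinfun.bilinear_simps)
  have w_form: "w v \<bullet>\<^sub>R v = c * (x v \<bullet>\<^sub>R v - l * (norm v)\<^sup>2)" for v
    by (simp add: w_app re_inner_simps re_inner_self)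
  have w_sa: "selfadjoint w"
    by (simp add: w_def z_def selfadjoint_scaleR selfadjoint_diff selfadjoint_id sa)
  have "norm w \<le> 1" by (simp add: w_def c_def divide_le_eq add_nonneg_pos)
  then have w_le: "norm (w v) \<le> norm v" for v
    using norm_blinfun[of w v] mult_right_mono[of "norm w" 1 "norm v"] by simp
  define a where "a = w o\<^sub>L w"
  have a_sa: "selfadjoint a"
    unfolding a_def by (intro selfadjoint_compose w_sa) (simp add: commuting_def)
  have a_form: "(id_blinfun - a) v \<bullet>\<^sub>R v = (norm v)\<^sup>2 - (norm (w v))\<^sup>2" for v
    by (simp add: a_def blinfun.bilinear_simps re_inner_simps selfadjoint_re_inner[OF w_sa, of "w v"] re_inner_self)
  have "norm (id_blinfun - a) \<le> 1"
  proof (rule norm_blinfun_bound)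
    show "norm ((id_blinfun - a) v) \<le> 1 * norm v" for v
      using norm_le_if_form_le[of "id_blinfun - a" 1 v] power_mono[OF w_le, of _ 2]
      by (simp add: a_form selfadjoint_diff selfadjoint_id a_sa)
  qed simp
  then obtain b where b: "selfadjoint b" "\<And>v. b (b v) = a v" "\<And>v. 0 \<le> b v \<bullet>\<^sub>R v"
    "\<And>v. b v \<bullet>\<^sub>R v = 0 \<Longrightarrow> b v = 0" "\<And>B. closed_algebra B \<Longrightarrow> a \<in> B \<Longrightarrow> b \<in> B"
    using positive_square_root[OF a_sa] by metis
  have b_comm: "commuting b T" if "commuting w T" for T
    using b(5)[OF closed_algebra_commutant[of T]] that by (simp add: a_def commuting_def)
  then have bw: "b (w v) = w (b v)" for v by (simp add: commuting_def)
  \<comment> \<open>\<open>b\<close> is \<open>\<bar>w\<bar>\<close>, so \<open>b + w\<close> and \<open>b - w\<close> are twice the positive and the negative part of \<open>w\<close>.\<close>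
  define p where "p = b + w"
  have p_sa: "selfadjoint p" by (simp add: p_def selfadjoint_add b w_sa)
  obtain P where P: "projection_op P" "\<And>v. P v = v \<longleftrightarrow> p v = 0" "\<And>T. commuting p T \<Longrightarrow> commuting P T"
    using kernel_projection[OF p_sa] by metis
  have P_comm: "commuting P T" if "commuting x T" for T
  proof -
    have "commuting w T" using that by (simp add: commuting_def w_app blinfun.bilinear_simps)
    with b_comm have "commuting p T" by (simp add: p_def commuting_def blinfun.bilinear_simps)
    then show ?thesis by (rule P(3))
  qed
  have "p (b v - w v) = 0" for v
    by (simp add: p_def blinfun.bilinear_simps b bw a_def)
  then have P_minus: "P (b v - w v) = b v - w v" for v
    by (simp add: P(2))
  have P_minus': "P (b v) - P (w v) = b v - w v" for v
    using P_minus[of v] by (simp add: blinfun.bilinear_simps)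
  have Pb: "P (b v) = b (P v)" and Pw: "P (w v) = w (P v)" for v
  proof -
    have w: "commuting x w" by (simp add: commuting_def w_app blinfun.bilinear_simps)
    have "commuting w x" using w by (rule commuting_sym)
    then have "commuting x b" by (metis b_comm commuting_sym)
    with w show "P (b v) = b (P v)" "P (w v) = w (P v)"
      using P_comm by (auto simp: commuting_def)
  qed
  have ker: "b v = w v" if "P v = 0" for v
    using P_minus'[of v] that by (simp add: Pb Pw blinfun.bilinear_simps)
  show ?thesis
  proof
    show "spectral_projection x l P"
      unfolding spectral_projection_def
    proof (intro conjI allI impI)
      show "projection_op P" by (rule P)
      show "commuting P x" by (rule P_comm) (simp add: commuting_def)
      show "x v \<bullet>\<^sub>R v \<le> l * (norm v)\<^sup>2" if "P v = v" for v
      proof -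
        have "w v = - b v" using that P(2)[of v] by (simp add: p_def blinfun.bilinear_simps add_eq_0_iff)
        then have "w v \<bullet>\<^sub>R v \<le> 0" using b(3)[of v] by (simp add: re_inner_simps)
        then show ?thesis using c by (simp add: w_form mult_le_0_iff)
      qed
      show "l * (norm v)\<^sup>2 < x v \<bullet>\<^sub>R v" if "P v = 0" "v \<noteq> 0" for v
      proof -
        have "w v \<bullet>\<^sub>R v \<noteq> 0"
        proof
          assume "w v \<bullet>\<^sub>R v = 0"
          then have "b v = 0" using b(4)[of v] ker[OF that(1)] by simp
          then have "p v = 0" using ker[OF that(1)] by (simp add: p_def blinfun.bilinear_simps)
          then have "P v = v" by (simp add: P(2))
          with that show False by simp
        qed
        then have "0 < w v \<bullet>\<^sub>R v" using b(3)[of v] ker[OF that(1)] by simp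
        then show ?thesis using c by (simp add: w_form zero_less_mult_iff)
      qed
    qed
    show "commuting P T" if "commuting x T" for T using that by (rule P_comm)
    show "(x - l *\<^sub>R id_blinfun) o\<^sub>L (id_blinfun - P) \<in> B"
      if B: "closed_algebra B" and "x - l *\<^sub>R id_blinfun \<in> B" for B
    proof -
      have "w \<in> B" using that by (simp add: w_def z_def closed_algebraD)
      then have "p \<in> B" using B by (simp add: p_def a_def b closed_algebraD)
      moreover have "(x - l *\<^sub>R id_blinfun) o\<^sub>L (id_blinfun - P) = (1 / (2 * c)) *\<^sub>R p"
      proof (rule blinfun_eqI)
        fix v
        define u where "u = v - P v"
        have u0: "P u = 0" by (simp add: u_def blinfun.bilinear_simps projection_idem P(1))
        have "p (P v) = 0" by (metis P(1,2) projection_idem)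
        then have "p v = p u" by (simp add: u_def blinfun.bilinear_simps)
        also have "\<dots> = (2 * c) *\<^sub>R (x u - l *\<^sub>R u)"
          using ker[OF u0] by (simp add: p_def blinfun.bilinear_simps w_app scaleR_2[symmetric])
        finally have "x u - l *\<^sub>R u = (1 / (2 * c)) *\<^sub>R p v" using c by simp
        then show "((x - l *\<^sub>R id_blinfun) o\<^sub>L (id_blinfun - P)) v = ((1 / (2 * c)) *\<^sub>R p) v"
          by (simp add: u_def blinfun.bilinear_simps scaleR_diff_right algebra_simps)
      qed
      ultimately show ?thesis using B by (simp add: closed_algebraD)
    qed
  qed
qed

text \<open>The device for comparing spectral projections. If \<open>Q v \<noteq> v\<close>, then \<open>u = v - Q v\<close>
  lies in the range of \<open>P\<close> and in the kernel of \<open>Q\<close>, where the two inequalities contradict each other.\<close>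

lemma spectral_projection_range_subset:
  assumes P: "spectral_projection x l P" and Q: "spectral_projection y m Q" and comm: "commuting P Q"
    and form: "\<And>u. P u = u \<Longrightarrow> Q u = 0 \<Longrightarrow> y u \<bullet>\<^sub>R u - m * (norm u)\<^sup>2 \<le> x u \<bullet>\<^sub>R u - l * (norm u)\<^sup>2"
    and "P v = v"
  shows "Q v = v"
proof (rule ccontr)
  assume "Q v \<noteq> v"
  define u where "u = v - Q v"
  have u: "u \<noteq> 0" "Q u = 0" "P u = u"
    using \<open>Q v \<noteq> v\<close> \<open>P v = v\<close> commuting_apply[OF comm, of v]
    by (auto simp: u_def blinfun.bilinear_simps projection_idem[OF spectral_projectionD(1)[OF Q]])
  show False
    using spectral_projectionD(3)[OF P u(3)] spectral_projectionD(4)[OF Q u(2,1)] form[OF u(3,2)] by linarith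
qed

text \<open>The projection built from the absolute value commutes with every other candidate, so there is
  only one candidate.\<close>

lemma spectral_projection_unique:
  assumes sa: "selfadjoint x" and P: "spectral_projection x l P" and Q: "spectral_projection x l Q"
  shows "P = Q"
proof -
  obtain R where R: "spectral_projection x l R" "\<And>T. commuting x T \<Longrightarrow> commuting R T"
    using spectral_projection_exists[OF sa] by metis
  have "P' = R" if P': "spectral_projection x l P'" for P'
  proof -
    have comm: "commuting R P'" using P' R(2) by (simp add: spectral_projection_def commuting_sym)
    then have comm': "commuting P' R" by (rule commuting_sym)
    show ?thesis
      by (rule projection_eqI)
         (auto intro: spectral_projection_range_subset[OF P' R(1) comm'] spectral_projection_range_subset[OF R(1) P' comm]
            spectral_projectionD(1) P' R(1))
  qed
  then show ?thesis using P Q by metis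
qed

lemma spectral_projection_commutant:
  assumes "selfadjoint x" "spectral_projection x l P" "commuting x T"
  shows "commuting P T"
proof -
  obtain Q where "spectral_projection x l Q" "\<And>T. commuting x T \<Longrightarrow> commuting Q T"
    using spectral_projection_exists[OF assms(1)] by metis
  then show ?thesis using spectral_projection_unique[OF assms(1,2)] assms(3) by metis
qed

lemma spectral_projection_part_in_algebra:
  assumes "selfadjoint x" "spectral_projection x 0 P" "closed_algebra B" "x \<in> B"
  shows "x o\<^sub>L (id_blinfun - P) \<in> B"
proof -
  obtain Q where "spectral_projection x 0 Q"
    and Q: "\<And>B. closed_algebra B \<Longrightarrow> x - 0 *\<^sub>R id_blinfun \<in> B \<Longrightarrow>
       (x - 0 *\<^sub>R id_blinfun) o\<^sub>L (id_blinfun - Q) \<in> B"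
    using spectral_projection_exists[OF assms(1), of 0] by metis
  then have "Q = P" using assms spectral_projection_unique by blast
  then show ?thesis using Q[of B] assms by simp
qed

lemma spectral_projections_commute:
  assumes "selfadjoint x" "selfadjoint y" "spectral_projection x l P" "spectral_projection y m Q"
    "commuting x y"
  shows "commuting P Q"
proof -
  have "commuting y P"
    by (rule commuting_sym, rule spectral_projection_commutant[OF assms(1,3,5)])
  then show ?thesis
    by (rule commuting_sym[OF spectral_projection_commutant[OF assms(2,4)]])
qed

lemma spectral_projection_mono:
  assumes "selfadjoint x" "spectral_projection x l P" "spectral_projection x m Q" "l \<le> m" "P v = v"
  shows "Q v = v"
proof (rule spectral_projection_range_subset[OF assms(2,3) _ _ assms(5)])
  show "commuting P Q"
    by (rule spectral_projections_commute[OF assms(1,1,2,3)]) (simp add: commuting_def)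
qed (simp add: mult_right_mono assms)

section \<open>The spectral family\<close>

text \<open>The strong operator topology is pulled back from the product topology on functions.\<close>

lemma limitin_strong_iff:
  fixes f :: "'i \<Rightarrow> 'a::real_normed_vector \<Rightarrow>\<^sub>L 'b::real_normed_vector"
  shows "limitin strong_operator_topology f T F \<longleftrightarrow> (\<forall>v. ((\<lambda>i. f i v) \<longlongrightarrow> T v) F)"
proof
  assume lim: "limitin strong_operator_topology f T F"
  show "\<forall>v. ((\<lambda>i. f i v) \<longlongrightarrow> T v) F"
    using continuous_map_limit[OF strong_operator_topology_continuous_evaluation lim]
    by (simp add: o_def)
next
  assume lim: "\<forall>v. ((\<lambda>i. f i v) \<longlongrightarrow> T v) F"
  have "((\<lambda>i. blinfun_apply (f i)) \<longlongrightarrow> blinfun_apply T) F"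
    unfolding limitin_canonical_iff[symmetric] euclidean_product_topology[symmetric] limitin_componentwise
    using lim by simp
  then have lim': "\<And>V. open V \<Longrightarrow> blinfun_apply T \<in> V \<Longrightarrow> \<forall>\<^sub>F i in F. blinfun_apply (f i) \<in> V"
    by (simp add: tendsto_def)
  show "limitin strong_operator_topology f T F"
    unfolding limitin_def strong_operator_topology_topspace
  proof (intro conjI UNIV_I allI impI)
    fix U assume U: "openin strong_operator_topology U \<and> T \<in> U"
    then obtain V where "open V" "U = blinfun_apply -` V"
      unfolding strong_operator_topology_def openin_pullback_topology by auto
    then show "\<forall>\<^sub>F i in F. f i \<in> U" using lim'[of V] U by simp
  qed
qed

definition projection_family :: "(real \<Rightarrow> 'a::complex_hilbert_space \<Rightarrow>\<^sub>L 'a) \<Rightarrow> bool" where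
  "projection_family E \<longleftrightarrow> (\<forall>l. projection_op (E l)) \<and> (\<forall>l m. l \<le> m \<longrightarrow> op_le (E l) (E m))"

lemma projection_familyD:
  assumes "projection_family E"
  shows "projection_op (E l)" "l \<le> m \<Longrightarrow> E l v = v \<Longrightarrow> E m v = v"
    "l \<le> m \<Longrightarrow> E m (E l v) = E l v" "l \<le> m \<Longrightarrow> E l (E m v) = E l v"
    "l \<le> m \<Longrightarrow> E m v = 0 \<Longrightarrow> E l v = 0"
proof -
  have proj: "projection_op (E l)" for l using assms by (simp add: projection_family_def)
  have mono: "E m v = v" if "l \<le> m" "E l v = v" for l m v
    using assms that projection_le_iff_range[OF proj proj, of l m] by (simp add: projection_family_def)
  have absorb: "E m (E l v) = E l v" "E l (E m v) = E l v" if "l \<le> m" for l m v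
    by (rule projection_absorb[OF proj proj], rule mono[OF that], assumption)+
  show "projection_op (E l)" by (rule proj)
  show "l \<le> m \<Longrightarrow> E l v = v \<Longrightarrow> E m v = v" by (rule mono)
  show "l \<le> m \<Longrightarrow> E m (E l v) = E l v" "l \<le> m \<Longrightarrow> E l (E m v) = E l v"
    by (rule absorb; assumption)+
  show "l \<le> m \<Longrightarrow> E m v = 0 \<Longrightarrow> E l v = 0"
    using absorb(2)[of l m v] by (simp add: blinfun.zero_right)
qed

lemma projection_family_commuting: "projection_family E \<Longrightarrow> commuting (E l) (E m)"
  by (cases "l \<le> m") (simp_all add: commuting_def projection_familyD)

text \<open>The increments of a projection family along a partition decompose the identity into orthogonal
  pieces, and the forms of operators commuting with the family split accordingly.\<close>

lemma partition_decomposition: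
  fixes E :: "real \<Rightarrow> 'a::complex_hilbert_space \<Rightarrow>\<^sub>L 'a" and p :: "nat \<Rightarrow> real"
  assumes fam: "projection_family E"
    and p: "E (p 0) = 0" "E (p n) = id_blinfun" "\<forall>i<n. p i \<le> p (Suc i)"
  defines "D \<equiv> \<lambda>i. E (p (Suc i)) - E (p i)"
  shows "\<And>i. i < n \<Longrightarrow> E (p (Suc i)) (D i v) = D i v" "\<And>i. i < n \<Longrightarrow> E (p i) (D i v) = 0"
    "selfadjoint (D i)" "\<And>i. i < n \<Longrightarrow> D i v \<bullet>\<^sub>R v = (norm (D i v))\<^sup>2"
    "(norm v)\<^sup>2 = (\<Sum>i<n. (norm (D i v))\<^sup>2)"
    "\<And>T. selfadjoint T \<Longrightarrow> (\<And>l. commuting (E l) T) \<Longrightarrow> T v \<bullet>\<^sub>R v = (\<Sum>i<n. T (D i v) \<bullet>\<^sub>R D i v)"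
proof -
  note proj = projection_familyD(1)[OF fam] and absorb = projection_familyD(3,4)[OF fam]
  note idem = projection_idem[OF proj]
  show sa: "selfadjoint (D i)" for i
    by (simp add: D_def selfadjoint_diff projection_selfadjoint proj)
  show D1: "E (p (Suc i)) (D i v) = D i v" if "i < n" for i v
    using that by (simp add: D_def blinfun.bilinear_simps absorb idem p)
  show D2: "E (p i) (D i v) = 0" if "i < n" for i v
    using that by (simp add: D_def blinfun.bilinear_simps absorb idem p)
  have idem_D: "D i (D i v) = D i v" if "i < n" for i v
    using D1[OF that] D2[OF that] by (simp add: D_def[THEN meta_eq_to_obj_eq, THEN fun_cong, of i] blinfun.diff_left)
  show form: "D i v \<bullet>\<^sub>R v = (norm (D i v))\<^sup>2" if "i < n" for i v
    by (metis idem_D re_inner_self sa selfadjoint_re_inner that)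
  have sum: "(\<Sum>i<n. D i v) = v" for v
  proof -
    have "(\<Sum>i<n. D i v) = (\<Sum>i<n. E (p (Suc i)) v - E (p i) v)"
      by (simp add: D_def blinfun.bilinear_simps)
    also have "\<dots> = v" using sum_lessThan_telescope[of "\<lambda>i. E (p i) v" n] by (simp add: p)
    finally show ?thesis .
  qed
  have "(norm v)\<^sup>2 = (\<Sum>i<n. D i v) \<bullet>\<^sub>R v" unfolding sum by (simp add: re_inner_self)
  also have "\<dots> = (\<Sum>i<n. (norm (D i v))\<^sup>2)"
    unfolding re_inner.sum_left by (intro sum.cong form) auto
  finally show "(norm v)\<^sup>2 = (\<Sum>i<n. (norm (D i v))\<^sup>2)" .
  show "T v \<bullet>\<^sub>R v = (\<Sum>i<n. T (D i v) \<bullet>\<^sub>R D i v)" if T: "selfadjoint T" "\<And>l. commuting (E l) T" for T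
  proof -
    have TD: "T (D i w) = D i (T w)" for i w
      using T(2) by (simp add: D_def blinfun.bilinear_simps commuting_def)
    have "T v \<bullet>\<^sub>R v = T v \<bullet>\<^sub>R (\<Sum>i<n. D i v)" unfolding sum ..
    also have "\<dots> = (\<Sum>i<n. T v \<bullet>\<^sub>R D i v)" by (rule re_inner.sum_right)
    also have "\<dots> = (\<Sum>i<n. T (D i v) \<bullet>\<^sub>R D i v)"
    proof (rule sum.cong)
      fix i assume "i \<in> {..<n}"
      then have "T v \<bullet>\<^sub>R D i v = T v \<bullet>\<^sub>R D i (D i v)" by (simp add: idem_D)
      also have "\<dots> = D i (T v) \<bullet>\<^sub>R D i v" by (simp add: selfadjoint_re_inner[OF sa])
      finally show "T v \<bullet>\<^sub>R D i v = T (D i v) \<bullet>\<^sub>R D i v" by (simp add: TD)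
    qed simp
    finally show ?thesis .
  qed
qed

text \<open>It suffices to bound the form on the range of each increment \<open>E m - E l\<close> by the length of \<open>[l, m]\<close>:
  the decomposition along a partition adds these bounds up, and a self-adjoint operator with small
  form has small norm.\<close>

lemma has_spectral_integralI:
  fixes E :: "real \<Rightarrow> 'a::complex_hilbert_space \<Rightarrow>\<^sub>L 'a"
  assumes fam: "projection_family E"
    and T: "selfadjoint T" "\<And>l. commuting (E l) T"
    and form: "\<And>l m t v. l \<le> t \<Longrightarrow> t \<le> m \<Longrightarrow> E m v = v \<Longrightarrow> E l v = 0 \<Longrightarrow>
      \<bar>T v \<bullet>\<^sub>R v - f t * (norm v)\<^sup>2\<bar> \<le> (m - l) * (norm v)\<^sup>2"
  shows "has_spectral_integral f E T"
  unfolding has_spectral_integral_def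
proof (intro allI impI)
  fix \<epsilon> :: real assume "\<epsilon> > 0"
  show "\<exists>\<delta>>0. \<forall>(n::nat) p t.
        E (p 0) = 0 \<and> E (p n) = id_blinfun \<and>
        (\<forall>i<n. p i \<le> t i \<and> t i \<le> p (Suc i) \<and> p (Suc i) - p i < \<delta>) \<longrightarrow>
        norm ((\<Sum>i<n. f (t i) *\<^sub>R (E (p (Suc i)) - E (p i))) - T) < \<epsilon>"
  proof (intro exI[of _ "\<epsilon> / 2"] conjI allI impI)
    fix n :: nat and p t :: "nat \<Rightarrow> real"
    assume p: "E (p 0) = 0 \<and> E (p n) = id_blinfun \<and>
        (\<forall>i<n. p i \<le> t i \<and> t i \<le> p (Suc i) \<and> p (Suc i) - p i < \<epsilon> / 2)"
    define D where "D i = E (p (Suc i)) - E (p i)" for i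
    define S where "S = (\<Sum>i<n. f (t i) *\<^sub>R D i)"
    have p': "E (p 0) = 0" "E (p n) = id_blinfun" "\<forall>i<n. p i \<le> p (Suc i)"
      using p by (auto intro: order_trans)
    note D = partition_decomposition[where E = E and p = p and n = n, OF fam p', folded D_def]
    have S_sa: "selfadjoint (S - T)"
      unfolding S_def by (intro selfadjoint_diff selfadjoint_sum selfadjoint_scaleR D(3) T(1))
    have "\<bar>(S - T) v \<bullet>\<^sub>R v\<bar> \<le> (\<epsilon> / 2) * (norm v)\<^sup>2" for v
    proof -
      have "S v \<bullet>\<^sub>R v = (\<Sum>i<n. f (t i) * (norm (D i v))\<^sup>2)"
        unfolding S_def by (simp add: blinfun.sum_left blinfun.bilinear_simps re_inner.sum_left re_inner_simps D(4))
      moreover have "T v \<bullet>\<^sub>R v = (\<Sum>i<n. T (D i v) \<bullet>\<^sub>R D i v)"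
        by (rule D(6)[OF T])
      ultimately have "(S - T) v \<bullet>\<^sub>R v = (\<Sum>i<n. f (t i) * (norm (D i v))\<^sup>2 - T (D i v) \<bullet>\<^sub>R D i v)"
        by (simp add: blinfun.bilinear_simps re_inner_simps sum_subtractf)
      also have "\<bar>\<dots>\<bar> \<le> (\<Sum>i<n. (\<epsilon> / 2) * (norm (D i v))\<^sup>2)"
      proof (intro order_trans[OF sum_abs] sum_mono)
        fix i assume "i \<in> {..<n}"
        then have i: "i < n" by simp
        have "\<bar>T (D i v) \<bullet>\<^sub>R D i v - f (t i) * (norm (D i v))\<^sup>2\<bar> \<le> (p (Suc i) - p i) * (norm (D i v))\<^sup>2"
          using p i by (intro form D(1,2)) auto
        also have "\<dots> \<le> (\<epsilon> / 2) * (norm (D i v))\<^sup>2"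
          using p i by (intro mult_right_mono) (auto intro: less_imp_le)
        finally show "\<bar>f (t i) * (norm (D i v))\<^sup>2 - T (D i v) \<bullet>\<^sub>R D i v\<bar> \<le> (\<epsilon> / 2) * (norm (D i v))\<^sup>2"
          by (simp add: abs_minus_commute)
      qed
      also have "\<dots> = (\<epsilon> / 2) * (norm v)\<^sup>2"
        unfolding D(5)[of v] sum_distrib_left ..
      finally show ?thesis .
    qed
    then have "norm (S - T) \<le> \<epsilon> / 2"
      using \<open>\<epsilon> > 0\<close> by (intro norm_blinfun_bound norm_le_if_form_le[OF S_sa]) auto
    then show "norm ((\<Sum>i<n. f (t i) *\<^sub>R (E (p (Suc i)) - E (p i))) - T) < \<epsilon>"
      using \<open>\<epsilon> > 0\<close> by (simp add: S_def D_def)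
  qed (use \<open>\<epsilon> > 0\<close> in simp)
qed

text \<open>A single sequence of partitions of mesh tending to 0 turns all spectral integrals for \<open>E\<close> into limits
  of sequences.\<close>

definition exhausting_partitions ::
    "(real \<Rightarrow> 'a::real_normed_vector \<Rightarrow>\<^sub>L 'a) \<Rightarrow> (nat \<Rightarrow> nat) \<Rightarrow> (nat \<Rightarrow> nat \<Rightarrow> real) \<Rightarrow> bool" where
  "exhausting_partitions E n p \<longleftrightarrow> (\<forall>k. E (p k 0) = 0 \<and> E (p k (n k)) = id_blinfun \<and>
     (\<forall>i. p k i \<le> p k (Suc i) \<and> p k (Suc i) - p k i = inverse (real (Suc k))))"

lemma exhausting_partitionsD:
  assumes "exhausting_partitions E n p"
  shows "E (p k 0) = 0" "E (p k (n k)) = id_blinfun" "p k i \<le> p k (Suc i)"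
    "p k (Suc i) - p k i = inverse (real (Suc k))"
  using assms by (auto simp: exhausting_partitions_def)

lemma exhausting_partitions_exist:
  fixes E :: "real \<Rightarrow> 'a::complex_hilbert_space \<Rightarrow>\<^sub>L 'a"
  assumes supp: "\<exists>a b. (\<forall>l<a. E l = 0) \<and> (\<forall>l\<ge>b. E l = id_blinfun)"
  shows "\<exists>n p. exhausting_partitions E n p"
proof -
  obtain a b where ab: "\<And>l. l < a \<Longrightarrow> E l = 0" "\<And>l. l \<ge> b \<Longrightarrow> E l = id_blinfun"
    using supp by auto
  define p where "p k i = a - 1 + real i * inverse (real (Suc k))" for k i :: nat
  define n where "n k = nat \<lceil>(b - a + 1) * real (Suc k)\<rceil>" for k :: nat
  have "b \<le> p k (n k)" for k
  proof -
    have "(b - a + 1) * real (Suc k) \<le> real (n k)" unfolding n_def by linarith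
    then have "b - a + 1 \<le> real (n k) * inverse (real (Suc k))" by (simp add: field_simps)
    then show ?thesis by (simp add: p_def)
  qed
  then have p: "E (p k 0) = 0" "E (p k (n k)) = id_blinfun" "p k i \<le> p k (Suc i)"
    "p k (Suc i) - p k i = inverse (real (Suc k))" for k i
    using ab by (simp_all add: p_def algebra_simps)
  then show ?thesis unfolding exhausting_partitions_def by blast
qed

lemma riemann_sums_tendsto:
  fixes E :: "real \<Rightarrow> 'a::complex_hilbert_space \<Rightarrow>\<^sub>L 'a"
  assumes int: "has_spectral_integral f E T" and p: "exhausting_partitions E n p"
  shows "(\<lambda>k. \<Sum>i<n k. f (p k i) *\<^sub>R (E (p k (Suc i)) - E (p k i))) \<longlonglongrightarrow> T"
proof (rule LIMSEQ_I)
  note p = exhausting_partitionsD[OF p]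
  fix \<epsilon> :: real assume "\<epsilon> > 0"
  with int obtain \<delta> where "\<delta> > 0" and \<delta>: "\<forall>(n::nat) p t. E (p 0) = 0 \<and> E (p n) = id_blinfun \<and>
    (\<forall>i<n. p i \<le> t i \<and> t i \<le> p (Suc i) \<and> p (Suc i) - p i < \<delta>) \<longrightarrow>
    norm ((\<Sum>i<n. f (t i) *\<^sub>R (E (p (Suc i)) - E (p i))) - T) < \<epsilon>"
    unfolding has_spectral_integral_def by blast
  obtain N where N: "inverse (real (Suc N)) < \<delta>" using reals_Archimedean[OF \<open>\<delta> > 0\<close>] by blast
  show "\<exists>N. \<forall>k\<ge>N. norm ((\<Sum>i<n k. f (p k i) *\<^sub>R (E (p k (Suc i)) - E (p k i))) - T) < \<epsilon>"
  proof (intro exI allI impI)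
    fix k assume "N \<le> k"
    then have "inverse (real (Suc k)) \<le> inverse (real (Suc N))" by (simp add: le_imp_inverse_le)
    with N have "p k (Suc i) - p k i < \<delta>" for i unfolding p(4) by linarith
    then show "norm ((\<Sum>i<n k. f (p k i) *\<^sub>R (E (p k (Suc i)) - E (p k i))) - T) < \<epsilon>"
      by (intro \<delta>[rule_format]) (simp add: p)
  qed
qed

lemma has_spectral_integral_unique:
  fixes E :: "real \<Rightarrow> 'a::complex_hilbert_space \<Rightarrow>\<^sub>L 'a"
  assumes "has_spectral_integral f E S" "has_spectral_integral f E T"
    and supp: "\<exists>a b. (\<forall>l<a. E l = 0) \<and> (\<forall>l\<ge>b. E l = id_blinfun)"
  shows "S = T"
proof -
  obtain n p where "exhausting_partitions E n p"
    using exhausting_partitions_exist[OF supp] by blast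
  then show ?thesis using assms(1,2) by (blast intro: LIMSEQ_unique riemann_sums_tendsto)
qed

lemma spectral_resolutionD:
  assumes "spectral_resolution x E"
  shows "projection_family E" "((\<lambda>m. E m v) \<longlongrightarrow> E l v) (at_right l)"
    "\<exists>a b. (\<forall>l<a. E l = 0) \<and> (\<forall>l\<ge>b. E l = id_blinfun)" "has_spectral_integral (\<lambda>l. l) E x"
  using assms by (simp_all add: spectral_resolution_def projection_family_def limitin_strong_iff)

text \<open>Riemann sums on the range (kernel) of \<open>E l\<close> only involve nodes below (above) \<open>l\<close>, up to the mesh,
  which gives the inequalities in the limit. A vector in the kernel of \<open>E l\<close> with equality
  would be fixed by \<open>E m\<close> for all \<open>m > l\<close>, hence by \<open>E l\<close>, because the family is right-continuous.\<close>

lemma spectral_resolution_projection: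
  fixes x :: "'a::complex_hilbert_space \<Rightarrow>\<^sub>L 'a"
  assumes E: "spectral_resolution x E" and sa: "selfadjoint x"
  shows "spectral_projection x l (E l)"
proof -
  note fam = spectral_resolutionD(1)[OF E]
  note proj = projection_familyD(1)[OF fam] and mono = projection_familyD(2)[OF fam]
  note E_comm = projection_family_commuting[OF fam]
  obtain n p where part: "exhausting_partitions E n p"
    using exhausting_partitions_exist[OF spectral_resolutionD(3)[OF E]] by blast
  note p = exhausting_partitionsD[OF part]
  note lim = riemann_sums_tendsto[OF spectral_resolutionD(4)[OF E] part]
  define D where "D k i = E (p k (Suc i)) - E (p k i)" for k i
  define S where "S k = (\<Sum>i<n k. p k i *\<^sub>R D k i)" for k
  have S: "S \<longlonglongrightarrow> x" using lim by (simp add: S_def[abs_def] D_def)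
  have p3: "\<forall>i<m. p k i \<le> p k (Suc i)" for m k using p(3) by simp
  note D = partition_decomposition[where E = E and p = "p _" and n = "n _", OF fam p(1,2) p3, folded D_def]
  have x_comm: "commuting (E l) x" for l
  proof -
    have B: "closed_algebra {S. commuting S (E l)}" by (rule closed_algebra_commutant)
    have "p k i *\<^sub>R D k i \<in> {S. commuting S (E l)}" for k i
      unfolding D_def by (intro closed_algebraD[OF B]) (simp_all add: E_comm)
    then have "(\<Sum>i\<in>I. p k i *\<^sub>R D k i) \<in> {S. commuting S (E l)}" for k I
      by (induction I rule: infinite_finite_induct) (auto intro: closed_algebraD[OF B, simplified])
    then have "x \<in> {S. commuting S (E l)}"
      by (intro closed_sequentially[OF closed_algebraD(1)[OF B] _ S]) (simp add: S_def)
    then show ?thesis by (auto intro: commuting_sym)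
  qed
  have S_form: "(\<lambda>k. \<Sum>i<n k. p k i * (norm (D k i v))\<^sup>2) \<longlonglongrightarrow> x v \<bullet>\<^sub>R v" for v
  proof -
    have "S k v \<bullet>\<^sub>R v = (\<Sum>i<n k. p k i * (norm (D k i v))\<^sup>2)" for k
      unfolding S_def by (simp add: blinfun.sum_left blinfun.bilinear_simps re_inner.sum_left re_inner_simps D(4))
    moreover have "(\<lambda>k. S k v \<bullet>\<^sub>R v) \<longlonglongrightarrow> x v \<bullet>\<^sub>R v"
      by (intro re_inner.tendsto blinfun.tendsto S tendsto_const)
    ultimately show ?thesis by simp
  qed
  have upper: "x v \<bullet>\<^sub>R v \<le> l * (norm v)\<^sup>2" if v: "E l v = v" for l v
  proof (rule LIMSEQ_le_const2[OF S_form], intro exI allI impI)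
    fix k
    have "(\<Sum>i<n k. p k i * (norm (D k i v))\<^sup>2) \<le> (\<Sum>i<n k. l * (norm (D k i v))\<^sup>2)"
    proof (rule sum_mono)
      fix i
      show "p k i * (norm (D k i v))\<^sup>2 \<le> l * (norm (D k i v))\<^sup>2"
      proof (cases "p k i \<le> l")
        case False
        then have "l \<le> p k i" "l \<le> p k (Suc i)" using p(3)[of k i] by linarith+
        then have "D k i v = 0" using mono[OF _ v] by (simp add: D_def blinfun.diff_left)
        then show ?thesis by simp
      qed (simp add: mult_right_mono)
    qed
    then show "(\<Sum>i<n k. p k i * (norm (D k i v))\<^sup>2) \<le> l * (norm v)\<^sup>2"
      unfolding D(5)[of v k] sum_distrib_left .
  qed
  have lower: "l * (norm v)\<^sup>2 \<le> x v \<bullet>\<^sub>R v" if v: "E l v = 0" for l v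
  proof (rule LIMSEQ_le[OF _ S_form])
    have "(\<lambda>k. (l - inverse (real (Suc k))) * (norm v)\<^sup>2) \<longlonglongrightarrow> (l - 0) * (norm v)\<^sup>2"
      by (intro tendsto_intros LIMSEQ_inverse_real_of_nat)
    then show "(\<lambda>k. (l - inverse (real (Suc k))) * (norm v)\<^sup>2) \<longlonglongrightarrow> l * (norm v)\<^sup>2" by simp
    have "(l - inverse (real (Suc k))) * (norm v)\<^sup>2 \<le> (\<Sum>i<n k. p k i * (norm (D k i v))\<^sup>2)" for k
      unfolding D(5)[of v k] sum_distrib_left
    proof (rule sum_mono)
      fix i
      show "(l - inverse (real (Suc k))) * (norm (D k i v))\<^sup>2 \<le> p k i * (norm (D k i v))\<^sup>2"
      proof (cases "l \<le> p k (Suc i)")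
        case True
        then show ?thesis using p(4)[of k i] by (intro mult_right_mono) simp_all
      next
        case False
        then have "p k i \<le> l" "p k (Suc i) \<le> l" using p(3)[of k i] by linarith+
        then have "D k i v = 0" using projection_familyD(5)[OF fam _ v] by (simp add: D_def blinfun.diff_left)
        then show ?thesis by simp
      qed
    qed
    then show "\<exists>N. \<forall>k\<ge>N. (l - inverse (real (Suc k))) * (norm v)\<^sup>2 \<le> (\<Sum>i<n k. p k i * (norm (D k i v))\<^sup>2)"
      by blast
  qed
  show ?thesis
    unfolding spectral_projection_def
  proof (intro conjI allI impI)
    show "l * (norm v)\<^sup>2 < x v \<bullet>\<^sub>R v" if v: "E l v = 0" "v \<noteq> 0" for v
    proof (rule ccontr)
      assume "\<not> l * (norm v)\<^sup>2 < x v \<bullet>\<^sub>R v"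
      then have le: "x v \<bullet>\<^sub>R v \<le> l * (norm v)\<^sup>2" by simp
      have "E m v = v" if "m > l" for m
      proof -
        define u w where "u = v - E m v" and "w = E m v"
        have "u + w = v" by (simp add: u_def w_def)
        have Emu: "E m u = 0" by (simp add: u_def blinfun.bilinear_simps projection_idem proj)
        have Emw: "E m w = w" by (simp add: w_def projection_idem proj)
        have Elw: "E l w = 0"
          unfolding w_def using commuting_apply[OF E_comm, of l m v] v by (simp add: blinfun.bilinear_simps)
        have uw: "u \<bullet>\<^sub>R w = 0"
          by (metis Emu Emw proj projection_selfadjoint re_inner.zero_left selfadjoint_re_inner)
        have xuw: "x u \<bullet>\<^sub>R w = 0"
          by (metis Emu Emw commuting_apply[OF x_comm] blinfun.zero_right proj projection_selfadjoint
              re_inner.zero_left selfadjoint_re_inner)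
        then have xwu: "x w \<bullet>\<^sub>R u = 0"
          by (metis re_inner_commute sa selfadjoint_re_inner)
        have "x v \<bullet>\<^sub>R v = x u \<bullet>\<^sub>R u + x w \<bullet>\<^sub>R w"
          unfolding \<open>u + w = v\<close>[symmetric] by (simp add: blinfun.bilinear_simps re_inner_simps xuw xwu)
        moreover have "(norm v)\<^sup>2 = (norm u)\<^sup>2 + (norm w)\<^sup>2"
          unfolding \<open>u + w = v\<close>[symmetric] by (simp add: norm_add_square uw)
        ultimately have "m * (norm u)\<^sup>2 \<le> l * (norm u)\<^sup>2"
          using le lower[OF Emu] lower[OF Elw] by (simp add: algebra_simps)
        then have "u = 0" using that by (auto simp: mult_le_cancel_right)
        then show ?thesis by (simp add: u_def)
      qed
      then have "((\<lambda>m. E m v) \<longlongrightarrow> v) (at_right l)"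
        by (intro tendsto_eventually) (auto simp: eventually_at_filter)
      then have "E l v = v"
        using spectral_resolutionD(2)[OF E, of v l] tendsto_unique trivial_limit_at_right_real by blast
      with v show False by simp
    qed
  qed (use proj x_comm upper in auto)
qed

lemma abs_form_le_norm: "\<bar>x v \<bullet>\<^sub>R v\<bar> \<le> norm x * (norm v)\<^sup>2"
  for x :: "'a::complex_hilbert_space \<Rightarrow>\<^sub>L 'a"
  using order_trans[OF abs_re_inner_le_norm mult_right_mono[OF norm_blinfun norm_ge_zero], of x v]
  by (simp add: power2_eq_square mult.assoc)

text \<open>Right continuity: the limit \<open>w\<close> of \<open>E (s n) v\<close> along a sequence \<open>s n\<close> decreasing to \<open>l\<close> differs from
  \<open>E l v\<close> by a vector \<open>u\<close> with \<open>E l u = 0\<close> and \<open>\<langle>x u, u\<rangle> \<le> l \<parallel>u\<parallel>\<^sup>2\<close>, so it vanishes by strictness.\<close>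

lemma spectral_projection_resolution:
  fixes x :: "'a::complex_hilbert_space \<Rightarrow>\<^sub>L 'a"
  assumes sa: "selfadjoint x" and E: "\<And>l. spectral_projection x l (E l)"
  shows "spectral_resolution x E"
proof -
  note proj = spectral_projectionD(1)[OF E] and comm = spectral_projectionD(2)[OF E]
  have mono: "E m v = v" if "l \<le> m" "E l v = v" for l m v
    by (rule spectral_projection_mono[OF sa E E that])
  have fam: "projection_family E"
    using mono by (auto simp: projection_family_def proj projection_le_iff_range)
  note absorb = projection_familyD(3,4)[OF fam]
  have below: "E l = 0" if "l < - norm x" for l
  proof (rule blinfun_eqI, rule ccontr)
    fix v assume "E l v \<noteq> blinfun_apply 0 v"
    then have "0 < (norm (E l v))\<^sup>2" by simp
    then have "l * (norm (E l v))\<^sup>2 < - norm x * (norm (E l v))\<^sup>2"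
      by (rule mult_strict_right_mono[OF that])
    moreover have "x (E l v) \<bullet>\<^sub>R E l v \<le> l * (norm (E l v))\<^sup>2"
      by (rule spectral_projectionD(3)[OF E]) (rule projection_idem[OF proj])
    ultimately show False using abs_form_le_norm[of x "E l v"] by linarith
  qed
  have above: "E l = id_blinfun" if "norm x \<le> l" for l
  proof (rule blinfun_eqI, rule ccontr)
    fix v assume neq: "E l v \<noteq> id_blinfun v"
    define u where "u = v - E l v"
    have "E l u = 0" by (simp add: u_def blinfun.bilinear_simps projection_idem[OF proj])
    then have "l * (norm u)\<^sup>2 < x u \<bullet>\<^sub>R u"
      using neq by (intro spectral_projectionD(4)[OF E]) (auto simp: u_def)
    moreover have "norm x * (norm u)\<^sup>2 \<le> l * (norm u)\<^sup>2" by (rule mult_right_mono[OF that]) simp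
    ultimately show False using abs_form_le_norm[of x u] by linarith
  qed
  have right: "limitin strong_operator_topology E (E l) (at_right l)" for l
    unfolding limitin_strong_iff
  proof
    fix v
    define g where "g m = (norm (E m v))\<^sup>2" for m
    have dist: "(norm (E m v - E k v))\<^sup>2 = g m - g k" if "k \<le> m" for k m
    proof -
      have "E k (E m v) = E k v" by (rule absorb(2)[OF that])
      then show ?thesis using projection_pythagoras[OF proj[of k], of "E m v"] by (simp add: g_def)
    qed
    \<comment> \<open>It suffices to find the limit along a sequence decreasing to \<open>l\<close>, by monotonicity.\<close>
    define s where "s n = l + inverse (real (Suc n))" for n
    have s: "l < s n" for n by (simp add: s_def)
    have s_mono: "s n \<le> s m" if "m \<le> n" for m n
      using that by (simp add: s_def le_imp_inverse_le)
    have s_lim: "s \<longlonglongrightarrow> l"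
      unfolding s_def using tendsto_add[OF tendsto_const LIMSEQ_inverse_real_of_nat, of l] by simp
    have g_mono: "g k \<le> g m" if "k \<le> m" for k m
      using dist[OF that] zero_le_power2[of "norm (E m v - E k v)"] by linarith
    have "decseq (\<lambda>n. g (s n))" by (auto simp: decseq_def intro!: g_mono s_mono)
    then obtain L where L: "(\<lambda>n. g (s n)) \<longlonglongrightarrow> L"
      using decseq_convergent[of "\<lambda>n. g (s n)" 0] by (auto simp: g_def)
    have "Cauchy (\<lambda>n. E (s n) v)"
    proof (rule CauchyI)
      fix \<epsilon> :: real assume "\<epsilon> > 0"
      then have "\<epsilon>\<^sup>2 / 2 > 0" by simp
      with L obtain N where N: "\<And>n. n \<ge> N \<Longrightarrow> \<bar>g (s n) - L\<bar> < \<epsilon>\<^sup>2 / 2"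
        by (metis LIMSEQ_D real_norm_def)
      have "norm (E (s m) v - E (s n) v) < \<epsilon>" if "N \<le> m" "N \<le> n" for m n
      proof -
        have "(norm (E (s m) v - E (s n) v))\<^sup>2 = \<bar>g (s m) - g (s n)\<bar>"
        proof (cases "s n \<le> s m")
          case True
          then show ?thesis using dist[OF True] g_mono[OF True] by simp
        next
          case False
          then have le: "s m \<le> s n" by simp
          then show ?thesis using dist[OF le] g_mono[OF le] by (simp add: norm_minus_commute)
        qed
        also have "\<dots> < \<epsilon>\<^sup>2" using N[OF that(1)] N[OF that(2)] by linarith
        finally show ?thesis
          using \<open>\<epsilon> > 0\<close> by (meson less_imp_le power_less_imp_less_base)
      qed
      then show "\<exists>N. \<forall>m\<ge>N. \<forall>n\<ge>N. norm (E (s m) v - E (s n) v) < \<epsilon>" by blast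
    qed
    then obtain w where w: "(\<lambda>n. E (s n) v) \<longlonglongrightarrow> w"
      by (auto simp: Cauchy_convergent_iff convergent_def)
    define u where "u = w - E l v"
    have "E (s n) w = w" for n
    proof (rule LIMSEQ_unique[OF _ w])
      have "\<forall>\<^sub>F k in sequentially. E (s n) (E (s k) v) = E (s k) v"
        using s_mono absorb(1) unfolding eventually_sequentially by blast
      moreover have "(\<lambda>k. E (s n) (E (s k) v)) \<longlonglongrightarrow> E (s n) w"
        by (intro blinfun.tendsto tendsto_const w)
      ultimately show "(\<lambda>k. E (s k) v) \<longlonglongrightarrow> E (s n) w"
        by (rule Lim_transform_eventually[rotated])
    qed
    then have u_upper: "E (s n) u = u" for n
      using absorb(1)[of l "s n" v] s[of n] by (simp add: u_def blinfun.bilinear_simps)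
    have "E l w = E l v"
    proof (rule LIMSEQ_unique)
      show "(\<lambda>k. E l (E (s k) v)) \<longlonglongrightarrow> E l w"
        by (intro blinfun.tendsto tendsto_const w)
      show "(\<lambda>k. E l (E (s k) v)) \<longlonglongrightarrow> E l v"
        using absorb(2)[of l] s by (simp add: less_imp_le)
    qed
    then have u_lower: "E l u = 0" by (simp add: u_def blinfun.bilinear_simps projection_idem[OF proj])
    have "x u \<bullet>\<^sub>R u \<le> l * (norm u)\<^sup>2"
    proof (rule LIMSEQ_le_const)
      show "(\<lambda>n. s n * (norm u)\<^sup>2) \<longlonglongrightarrow> l * (norm u)\<^sup>2" by (intro tendsto_intros s_lim)
      show "\<exists>N. \<forall>n\<ge>N. x u \<bullet>\<^sub>R u \<le> s n * (norm u)\<^sup>2"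
        using spectral_projectionD(3)[OF E u_upper] by blast
    qed
    then have "u = 0" using spectral_projectionD(4)[OF E u_lower] by fastforce
    then have lim: "(\<lambda>n. E (s n) v) \<longlonglongrightarrow> E l v" using w by (simp add: u_def)
    show "((\<lambda>m. E m v) \<longlongrightarrow> E l v) (at_right l)"
    proof (rule tendstoI)
      fix \<epsilon> :: real assume "\<epsilon> > 0"
      with lim obtain n where n: "norm (E (s n) v - E l v) < \<epsilon>"
        by (metis LIMSEQ_D order_refl)
      have "dist (E m v) (E l v) < \<epsilon>" if "l < m" "m < s n" for m
      proof -
        have "(norm (E m v - E l v))\<^sup>2 \<le> (norm (E (s n) v - E l v))\<^sup>2"
          using dist[of l m] dist[of l "s n"] g_mono[of m "s n"] that s[of n] by simp
        then have "norm (E m v - E l v) \<le> norm (E (s n) v - E l v)" by (rule power2_le_imp_le) simp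
        with n show ?thesis by (simp add: dist_norm)
      qed
      then show "\<forall>\<^sub>F m in at_right l. dist (E m v) (E l v) < \<epsilon>"
        using s[of n] by (auto simp: eventually_at_right)
    qed
  qed
  have "has_spectral_integral (\<lambda>l. l) E x"
  proof (rule has_spectral_integralI[OF fam sa])
    show "commuting (E l) x" for l using E by (simp add: spectral_projection_def)
    fix l m t :: real and v assume lm: "l \<le> t" "t \<le> m" and v: "E m v = v" "E l v = 0"
    have "x v \<bullet>\<^sub>R v \<le> m * (norm v)\<^sup>2" "l * (norm v)\<^sup>2 \<le> x v \<bullet>\<^sub>R v"
      using spectral_projectionD(3,5)[OF E] v by blast+
    moreover have "l * (norm v)\<^sup>2 \<le> t * (norm v)\<^sup>2" "t * (norm v)\<^sup>2 \<le> m * (norm v)\<^sup>2"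
      using lm by (simp_all add: mult_right_mono)
    ultimately show "\<bar>x v \<bullet>\<^sub>R v - t * (norm v)\<^sup>2\<bar> \<le> (m - l) * (norm v)\<^sup>2"
      unfolding left_diff_distrib by linarith
  qed
  then show ?thesis
    using fam right below above unfolding spectral_resolution_def projection_family_def by blast
qed

lemma spectral_family_resolution:
  assumes sa: "selfadjoint x"
  shows "spectral_resolution x (spectral_family x)"
  unfolding spectral_family_def
proof (rule theI'[where P = "spectral_resolution x"])
  have "\<forall>l. \<exists>P. spectral_projection x l P"
    using spectral_projection_exists[OF sa] by metis
  then obtain E where "\<And>l. spectral_projection x l (E l)" by metis
  then have "spectral_resolution x E" by (rule spectral_projection_resolution[OF sa])
  moreover have "F = G" if "spectral_resolution x F" "spectral_resolution x G" for F G
  proof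
    show "F l = G l" for l
      using spectral_resolution_projection[OF that(1) sa] spectral_resolution_projection[OF that(2) sa]
      by (rule spectral_projection_unique[OF sa])
  qed
  ultimately show "\<exists>!E. spectral_resolution x E" by blast
qed

lemma spectral_family_projection:
  "selfadjoint x \<Longrightarrow> spectral_projection x l (spectral_family x l)"
  by (intro spectral_resolution_projection spectral_family_resolution)

lemmas spectral_familyD = spectral_projectionD[OF spectral_family_projection]

lemma spectral_le_iff_range:
  assumes "selfadjoint x" "selfadjoint y"
  shows "x \<preceq>\<^sub>s y \<longleftrightarrow> (\<forall>l v. spectral_family y l v = v \<longrightarrow> spectral_family x l v = v)"
  using assms by (simp add: spectral_le_def projection_le_iff_range spectral_familyD(1))

lemma spectral_le_antisym:
  assumes "selfadjoint x" "selfadjoint y" "x \<preceq>\<^sub>s y" "y \<preceq>\<^sub>s x"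
  shows "x = y"
proof -
  have "spectral_family x = spectral_family y"
    using assms unfolding spectral_le_def
    by (intro ext op_le_antisym_projection spectral_familyD(1)) auto
  then have "spectral_resolution y (spectral_family x)"
    using spectral_family_resolution[OF assms(2)] by simp
  note x = spectral_resolutionD[OF spectral_family_resolution[OF assms(1)]]
    and y = spectral_resolutionD[OF this]
  show ?thesis by (rule has_spectral_integral_unique[OF x(4) y(4) x(3)])
qed

lemma spectral_family_above_norm:
  assumes sa: "selfadjoint x"
  shows "spectral_family x (norm x) v = v"
proof (rule ccontr)
  assume neq: "spectral_family x (norm x) v \<noteq> v"
  define u where "u = v - spectral_family x (norm x) v"
  have "spectral_family x (norm x) u = 0"
    by (simp add: u_def blinfun.bilinear_simps projection_idem[OF spectral_familyD(1)[OF sa]])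
  then have "norm x * (norm u)\<^sup>2 < x u \<bullet>\<^sub>R u"
    using neq by (intro spectral_familyD(4)[OF sa]) (auto simp: u_def)
  then show False using abs_form_le_norm[of x u] by linarith
qed

section \<open>The positive part\<close>

text \<open>The function \<open>max l 0\<close> is \<open>l\<close> times the indicator of \<open>(0, \<infinity>)\<close>. The indicator jumps at 0, but on an
  interval across 0 the product varies by at most the length of the interval.\<close>

lemma pos_part_eq:
  assumes sa: "selfadjoint x"
  shows "pos_part x = x o\<^sub>L (id_blinfun - spectral_family x 0)"
proof -
  define E where "E = spectral_family x"
  define T where "T = x o\<^sub>L (id_blinfun - E 0)"
  note E = spectral_familyD[OF sa, folded E_def]
  note res = spectral_resolutionD[OF spectral_family_resolution[OF sa], folded E_def]
  note fam = res(1)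
  have T_app: "T v = x (v - E 0 v)" for v by (simp add: T_def blinfun.bilinear_simps)
  have T_sa: "selfadjoint T"
    unfolding T_def
    by (intro selfadjoint_compose sa selfadjoint_diff selfadjoint_id projection_selfadjoint E(1))
       (simp add: commuting_def blinfun.bilinear_simps E(2))
  have T_form: "T v \<bullet>\<^sub>R v = x (v - E 0 v) \<bullet>\<^sub>R (v - E 0 v)" for v
  proof -
    have "x (v - E 0 v) \<bullet>\<^sub>R E 0 v = E 0 (x (v - E 0 v)) \<bullet>\<^sub>R v"
      by (simp add: selfadjoint_re_inner[OF projection_selfadjoint[OF E(1)]])
    also have "\<dots> = 0"
      by (simp add: E(2) blinfun.bilinear_simps projection_idem[OF E(1)] re_inner_simps)
    finally show ?thesis by (simp add: T_app re_inner.diff_right)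
  qed
  have T_nonneg: "0 \<le> T v \<bullet>\<^sub>R v" for v
    unfolding T_form using E(5)[of 0 "v - E 0 v"] by (simp add: blinfun.bilinear_simps projection_idem[OF E(1)])
  have "has_spectral_integral (\<lambda>l. max l 0) E T"
  proof (rule has_spectral_integralI[OF fam T_sa])
    show "commuting (E l) T" for l
      using projection_family_commuting[OF fam, of l 0] by (simp add: commuting_def T_app E(2) blinfun.bilinear_simps)
    fix l m t :: real and v assume lm: "l \<le> t" "t \<le> m" and v: "E m v = v" "E l v = 0"
    consider "m \<le> 0" | "0 \<le> l" | "l < 0" "0 < m" by linarith
    then show "\<bar>T v \<bullet>\<^sub>R v - max t 0 * (norm v)\<^sup>2\<bar> \<le> (m - l) * (norm v)\<^sup>2"
    proof cases
      case 1
      then have "E 0 v = v" using v projection_familyD(2)[OF fam] by blast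
      then show ?thesis using 1 lm by (simp add: T_app re_inner_simps blinfun.bilinear_simps max_def)
    next
      case 2
      then have "E 0 v = 0" using v projection_familyD(5)[OF fam] by blast
      then have "T v \<bullet>\<^sub>R v = x v \<bullet>\<^sub>R v" by (simp add: T_app)
      moreover have "x v \<bullet>\<^sub>R v \<le> m * (norm v)\<^sup>2" "l * (norm v)\<^sup>2 \<le> x v \<bullet>\<^sub>R v"
        using E(3,5) v by blast+
      moreover have "l * (norm v)\<^sup>2 \<le> t * (norm v)\<^sup>2" "t * (norm v)\<^sup>2 \<le> m * (norm v)\<^sup>2"
        using lm by (simp_all add: mult_right_mono)
      moreover have "max t 0 * (norm v)\<^sup>2 = t * (norm v)\<^sup>2" using 2 lm by simp
      ultimately show ?thesis unfolding left_diff_distrib by linarith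
    next
      \<comment> \<open>Both terms lie between 0 and \<open>m * (norm v)\<^sup>2\<close>.\<close>
      case 3
      define u where "u = v - E 0 v"
      have u: "E m u = u"
        using 3 projection_familyD(3)[OF fam, of 0 m v] by (simp add: u_def blinfun.bilinear_simps v)
      have "T v \<bullet>\<^sub>R v = x u \<bullet>\<^sub>R u" unfolding u_def by (rule T_form)
      also have "\<dots> \<le> m * (norm u)\<^sup>2" by (rule E(3)[OF u])
      also have "\<dots> \<le> m * (norm v)\<^sup>2"
        using 3 projection_pythagoras[OF E(1), of v 0] by (intro mult_left_mono) (simp_all add: u_def)
      finally have "T v \<bullet>\<^sub>R v \<le> m * (norm v)\<^sup>2" .
      moreover have "0 \<le> max t 0 * (norm v)\<^sup>2" "max t 0 * (norm v)\<^sup>2 \<le> m * (norm v)\<^sup>2" "l * (norm v)\<^sup>2 \<le> 0"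
        using 3 lm by (simp_all add: mult_right_mono mult_nonpos_nonneg)
      ultimately show ?thesis
        using T_nonneg[of v] unfolding left_diff_distrib by linarith
    qed
  qed
  then show ?thesis
    unfolding pos_part_def E_def[symmetric] T_def[symmetric]
    using has_spectral_integral_unique[OF _ _ res(3)] by blast
qed

lemma pos_part_apply:
  "selfadjoint x \<Longrightarrow> pos_part x v = x (v - spectral_family x 0 v)"
  by (simp add: pos_part_eq blinfun.bilinear_simps)

lemma pos_part_in_algebra:
  "selfadjoint x \<Longrightarrow> closed_algebra B \<Longrightarrow> x \<in> B \<Longrightarrow> pos_part x \<in> B"
  by (simp add: pos_part_eq spectral_projection_part_in_algebra spectral_family_projection)

text \<open>The spectral projection for \<open>(0, \<infinity>)\<close>.\<close>

definition pos_support :: "('a::complex_hilbert_space \<Rightarrow>\<^sub>L 'a) \<Rightarrow> ('a \<Rightarrow>\<^sub>L 'a)" where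
  "pos_support x = id_blinfun - spectral_family x 0"

lemma pos_support_projection: "selfadjoint x \<Longrightarrow> projection_op (pos_support x)"
  by (simp add: pos_support_def projection_complement spectral_familyD)

lemma spectral_family_commuting:
  "selfadjoint x \<Longrightarrow> commuting x T \<Longrightarrow> commuting (spectral_family x l) T"
  by (rule spectral_projection_commutant[OF _ spectral_family_projection])

lemma pos_support_commuting:
  "selfadjoint x \<Longrightarrow> commuting x T \<Longrightarrow> commuting (pos_support x) T"
  using spectral_family_commuting[of x T 0] by (simp add: pos_support_def commuting_def blinfun.bilinear_simps)

lemma pos_part_support:
  assumes "selfadjoint x"
  shows "pos_part x v = x (pos_support x v)" "pos_part x v = pos_support x (x v)"
  using pos_support_commuting[OF assms, of x] by (simp_all add: pos_part_apply[OF assms] pos_support_def blinfun.bilinear_simps commuting_def)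

lemma pos_part_form:
  assumes sa: "selfadjoint x"
  shows "pos_part x v \<bullet>\<^sub>R v = x (pos_support x v) \<bullet>\<^sub>R pos_support x v"
proof -
  have "pos_part x v = pos_support x (x (pos_support x v))"
    by (metis pos_part_support[OF sa] pos_support_projection[OF sa] projection_idem)
  then show ?thesis
    by (simp add: selfadjoint_re_inner projection_selfadjoint pos_support_projection sa)
qed

lemma pos_support_form_pos:
  assumes sa: "selfadjoint x" and v: "pos_support x v = v"
  shows "0 \<le> x v \<bullet>\<^sub>R v" "v \<noteq> 0 \<Longrightarrow> 0 < x v \<bullet>\<^sub>R v"
proof -
  have "spectral_family x 0 v = 0" using v by (simp add: pos_support_def blinfun.bilinear_simps)
  then show "0 \<le> x v \<bullet>\<^sub>R v" "v \<noteq> 0 \<Longrightarrow> 0 < x v \<bullet>\<^sub>R v"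
    using spectral_familyD(4,5)[OF sa, of 0 v] by simp_all
qed

lemma pos_part_nonneg: "selfadjoint x \<Longrightarrow> 0 \<le> pos_part x v \<bullet>\<^sub>R v"
  by (simp add: pos_part_form pos_support_form_pos projection_idem pos_support_projection)

lemma pos_part_selfadjoint:
  assumes "selfadjoint x" shows "selfadjoint (pos_part x)"
proof -
  have "commuting x (pos_support x)"
    by (rule commuting_sym, rule pos_support_commuting[OF assms]) (simp add: commuting_def)
  then have "selfadjoint (x o\<^sub>L pos_support x)"
    by (intro selfadjoint_compose assms) (simp_all add: projection_selfadjoint pos_support_projection assms)
  moreover have "pos_part x = x o\<^sub>L pos_support x"
    by (intro blinfun_eqI) (simp add: pos_part_support assms)
  ultimately show ?thesis by simp
qed

text \<open>The difference \<open>x - x\<^sup>+\<close> is the compression of \<open>x\<close> to the range of \<open>E\<^sub>0\<close>, where the form is at most 0.\<close>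

lemma pos_part_ge:
  assumes sa: "selfadjoint x" shows "x v \<bullet>\<^sub>R v \<le> pos_part x v \<bullet>\<^sub>R v"
proof -
  define E where "E = spectral_family x 0"
  note E = spectral_familyD[OF sa, of 0, folded E_def]
  have "x v - pos_part x v = E (x (E v))"
    by (simp add: pos_part_apply[OF sa] E_def[symmetric] blinfun.bilinear_simps E(2) projection_idem[OF E(1)])
  then have "x v \<bullet>\<^sub>R v - pos_part x v \<bullet>\<^sub>R v = x (E v) \<bullet>\<^sub>R E v"
    by (simp add: re_inner.diff_left[symmetric] selfadjoint_re_inner[OF projection_selfadjoint[OF E(1)]])
  also have "\<dots> \<le> 0" using E(3)[of "E v"] by (simp add: projection_idem[OF E(1)])
  finally show ?thesis by simp
qed

text \<open>If \<open>E\<^sub>l\<close> fixes \<open>v\<close>, it also fixes the part of \<open>v\<close> in the support, where \<open>x\<^sup>+\<close> agrees with \<open>x\<close>.\<close>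

lemma pos_part_form_le:
  assumes sa: "selfadjoint x" and v: "spectral_family x l v = v"
  shows "pos_part x v \<bullet>\<^sub>R v \<le> l * (norm (pos_support x v))\<^sup>2"
proof -
  have "commuting (spectral_family x 0) (spectral_family x l)"
    by (rule spectral_projections_commute[OF sa sa spectral_family_projection[OF sa] spectral_family_projection[OF sa]])
       (simp add: commuting_def)
  then have "spectral_family x l (pos_support x v) = pos_support x v"
    using v by (simp add: pos_support_def blinfun.bilinear_simps commuting_def, metis)
  then show ?thesis unfolding pos_part_form[OF sa] by (rule spectral_familyD(3)[OF sa])
qed

section \<open>Sums of positive parts of orthogonal elements\<close>

lemma orthogonal_commuting:
  assumes "selfadjoint x" "selfadjoint y" "x o\<^sub>L y = 0"
  shows "x (y v) = 0" "y (x v) = 0"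
proof -
  show xy: "x (y v) = 0" for v using assms(3) by (metis blinfun_apply_blinfun_compose zero_blinfun.rep_eq)
  have "y (x v) \<bullet>\<^sub>R w = 0" for w
    using xy[of w] by (simp add: selfadjoint_re_inner assms re_inner_simps)
  then show "y (x v) = 0" by (rule eq_0_if_re_inner_all)
qed

text \<open>A nonzero vector in the support of \<open>x\<close> that is also a value of \<open>y\<close> would be annihilated by \<open>x\<close>,
  although the form of \<open>x\<close> is strictly positive on its support.\<close>

lemma orthogonal_pos_support:
  assumes x: "selfadjoint x" and y: "selfadjoint y" and "x o\<^sub>L y = 0"
  shows "y (pos_support x v) = 0" "pos_support x (pos_support y v) = 0"
proof -
  note xy = orthogonal_commuting[OF assms]
  have "commuting x y" "commuting y x" by (simp_all add: commuting_def xy)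
  note comm = commuting_apply[OF pos_support_commuting[OF x \<open>commuting x y\<close>]]
  note idem = projection_idem[OF pos_support_projection]
  show y0: "y (pos_support x v) = 0" for v
  proof (rule ccontr)
    assume neq: "y (pos_support x v) \<noteq> 0"
    have "pos_support x (y (pos_support x v)) = y (pos_support x v)"
      by (simp add: comm idem x)
    then have "0 < x (y (pos_support x v)) \<bullet>\<^sub>R y (pos_support x v)"
      using neq by (rule pos_support_form_pos(2)[OF x])
    then show False by (simp add: xy re_inner_simps)
  qed
  show "pos_support x (pos_support y v) = 0"
  proof (rule ccontr)
    assume neq: "pos_support x (pos_support y v) \<noteq> 0"
    have "commuting y (pos_support x)"
      by (rule commuting_sym, rule pos_support_commuting[OF x \<open>commuting x y\<close>])
    then have "commuting (pos_support y) (pos_support x)"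
      by (rule pos_support_commuting[OF y])
    then have "pos_support y (pos_support x (pos_support y v)) = pos_support x (pos_support y v)"
      by (simp add: commuting_def idem y)
    then have "0 < y (pos_support x (pos_support y v)) \<bullet>\<^sub>R pos_support x (pos_support y v)"
      using neq by (rule pos_support_form_pos(2)[OF y])
    then show False by (simp add: y0 re_inner_simps)
  qed
qed

text \<open>Here the assumption that there are two elements enters: on the common spectral subspace below 0
  the form of \<open>y\<close> is strictly negative, yet \<open>y\<close> vanishes there.\<close>

lemma orthogonal_negative_trivial:
  assumes x: "selfadjoint x" and y: "selfadjoint y" and orth: "x o\<^sub>L y = 0" and "l < 0"
    and v: "spectral_family x l v = v" "spectral_family y l v = v"
  shows "v = 0"
proof -
  note xy = orthogonal_commuting[OF x y orth]
  have vanish: "w = 0" if "0 \<le> l * (norm w)\<^sup>2" for w :: 'a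
    using that \<open>l < 0\<close> by (simp add: zero_le_mult_iff)
  have "commuting x y" by (simp add: commuting_def xy)
  then have "spectral_family x l (y v) = y v"
    using spectral_family_commuting[OF x] v(1) by (simp add: commuting_def)
  then have "y v = 0"
    using spectral_familyD(3)[OF x, of l "y v"] by (intro vanish) (simp add: xy re_inner_simps)
  then show "v = 0"
    using spectral_familyD(3)[OF y v(2)] by (intro vanish) (simp add: re_inner_simps)
qed

lemma orthogonal_sum_norm:
  fixes f :: "'b \<Rightarrow> 'a::complex_hilbert_space"
  assumes "finite F" "\<And>x y. x \<in> F \<Longrightarrow> y \<in> F \<Longrightarrow> x \<noteq> y \<Longrightarrow> f x \<bullet>\<^sub>R f y = 0"
  shows "(norm (\<Sum>x\<in>F. f x))\<^sup>2 = (\<Sum>x\<in>F. (norm (f x))\<^sup>2)"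
  using assms
proof (induction F rule: finite_induct)
  case (insert a F)
  have "f a \<bullet>\<^sub>R (\<Sum>x\<in>F. f x) = 0"
    unfolding re_inner.sum_right by (rule sum.neutral) (use insert in auto)
  then show ?case using insert by (simp add: norm_add_square)
qed simp

text \<open>By Pythagoras the partial sums inherit the Cauchy property from the sums of squared norms.\<close>

lemma orthogonal_summable_on:
  fixes f :: "'b \<Rightarrow> 'a::complex_hilbert_space"
  assumes orth: "\<And>x y. x \<in> M \<Longrightarrow> y \<in> M \<Longrightarrow> x \<noteq> y \<Longrightarrow> f x \<bullet>\<^sub>R f y = 0"
    and bound: "\<And>F. finite F \<Longrightarrow> F \<subseteq> M \<Longrightarrow> (\<Sum>x\<in>F. (norm (f x))\<^sup>2) \<le> C"
  shows "f summable_on M"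
proof -
  have "(\<lambda>x. (norm (f x))\<^sup>2) summable_on M"
    by (rule nonneg_bdd_above_summable_on) (auto intro!: bdd_aboveI[of _ C] bound)
  then obtain L where L: "(sum (\<lambda>x. (norm (f x))\<^sup>2) \<longlongrightarrow> L) (finite_subsets_at_top M)"
    by (auto simp: summable_on_def has_sum_def)
  have "\<exists>P. eventually P (finite_subsets_at_top M) \<and>
      (\<forall>F F'. P F \<and> P F' \<longrightarrow> dist (sum f F) (sum f F') < e)" if "e > 0" for e
  proof -
    have "(e / 2)\<^sup>2 / 2 > 0" using that by simp
    with L have "\<forall>\<^sub>F F in finite_subsets_at_top M. dist (\<Sum>x\<in>F. (norm (f x))\<^sup>2) L < (e / 2)\<^sup>2 / 2"
      by (rule tendstoD)
    then obtain X where X: "finite X" "X \<subseteq> M"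
      and X_close: "\<forall>Y. finite Y \<and> X \<subseteq> Y \<and> Y \<subseteq> M \<longrightarrow> \<bar>(\<Sum>x\<in>Y. (norm (f x))\<^sup>2) - L\<bar> < (e / 2)\<^sup>2 / 2"
      unfolding eventually_finite_subsets_at_top dist_real_def by (elim exE conjE)
    have close: "norm (sum f Y - sum f X) < e / 2" if Y: "finite Y" "X \<subseteq> Y" "Y \<subseteq> M" for Y
    proof -
      have "(norm (sum f Y - sum f X))\<^sup>2 = (norm (sum f (Y - X)))\<^sup>2"
        using Y by (simp add: sum_diff)
      also have "\<dots> = (\<Sum>x\<in>Y - X. (norm (f x))\<^sup>2)"
        by (rule orthogonal_sum_norm) (use Y in \<open>auto intro!: orth\<close>)
      also have "\<dots> = (\<Sum>x\<in>Y. (norm (f x))\<^sup>2) - (\<Sum>x\<in>X. (norm (f x))\<^sup>2)"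
        using Y by (simp add: sum_diff)
      also have "\<dots> < (e / 2)\<^sup>2"
      proof -
        have "\<bar>(\<Sum>x\<in>Y. (norm (f x))\<^sup>2) - L\<bar> < (e / 2)\<^sup>2 / 2"
          "\<bar>(\<Sum>x\<in>X. (norm (f x))\<^sup>2) - L\<bar> < (e / 2)\<^sup>2 / 2"
          using X_close X Y by blast+
        then show ?thesis by linarith
      qed
      finally show ?thesis
        by (rule power_less_imp_less_base) (use \<open>e > 0\<close> in simp)
    qed
    have "dist (sum f F) (sum f F') < e"
      if "finite F" "X \<subseteq> F" "F \<subseteq> M" "finite F'" "X \<subseteq> F'" "F' \<subseteq> M" for F F'
      by (rule dist_triangle_half_l[of _ "sum f X"]; unfold dist_norm; rule close[OF that(1-3)] close[OF that(4-6)])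
    then show ?thesis
      using X(1,2)
      by (intro exI[of _ "\<lambda>F. finite F \<and> X \<subseteq> F \<and> F \<subseteq> M"]) (auto simp: eventually_finite_subsets_at_top)
  qed
  then have "cauchy_filter (filtermap (sum f) (finite_subsets_at_top M))"
    by (simp add: cauchy_filter_metric_filtermap)
  moreover have "complete (UNIV :: 'a set)"
    by (simp add: complete_UNIV)
  ultimately obtain w where "(sum f \<longlongrightarrow> w) (finite_subsets_at_top M)"
    using complete_uniform[where S = "UNIV :: 'a set"] by (force simp add: filterlim_def)
  then show ?thesis by (auto simp: summable_on_def has_sum_def)
qed

text \<open>Bessel's inequality for the mutually orthogonal support projections.\<close>

lemma pos_support_bessel:
  assumes sa: "\<And>x. x \<in> M \<Longrightarrow> selfadjoint x" and orth: "pairwise (\<lambda>x y. x o\<^sub>L y = 0) M"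
    and F: "finite F" "F \<subseteq> M"
  shows "(\<Sum>x\<in>F. (norm (pos_support x v))\<^sup>2) \<le> (norm v)\<^sup>2"
proof -
  define w where "w = (\<Sum>x\<in>F. pos_support x v)"
  have saF: "\<And>x. x \<in> F \<Longrightarrow> selfadjoint x" using sa F by auto
  have orthF: "x o\<^sub>L y = 0" if "x \<in> F" "y \<in> F" "x \<noteq> y" for x y
    using orth that F by (auto simp: pairwise_def)
  have "(norm w)\<^sup>2 = (\<Sum>x\<in>F. (norm (pos_support x v))\<^sup>2)"
    unfolding w_def
  proof (rule orthogonal_sum_norm[OF F(1)])
    fix x y assume xy: "x \<in> F" "y \<in> F" "x \<noteq> y"
    show "pos_support x v \<bullet>\<^sub>R pos_support y v = 0"
      using orthogonal_pos_support(2)[OF saF[OF xy(1)] saF[OF xy(2)] orthF[OF xy], of v]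
      by (simp add: selfadjoint_re_inner projection_selfadjoint pos_support_projection saF xy re_inner_simps)
  qed
  moreover have "w \<bullet>\<^sub>R v = (\<Sum>x\<in>F. (norm (pos_support x v))\<^sup>2)"
    unfolding w_def re_inner.sum_left
    by (intro sum.cong projection_form pos_support_projection saF) auto
  moreover have "0 \<le> (norm (w - v))\<^sup>2" by simp
  ultimately show ?thesis unfolding norm_diff_square by linarith
qed

text \<open>\<open>\<parallel>x\<^sup>+ v\<parallel>\<close> is at most \<open>K\<close> times the norm of the part of \<open>v\<close> in the support of \<open>x\<close>, so Bessel bounds
  the sums of squares by \<open>K\<^sup>2 \<parallel>v\<parallel>\<^sup>2\<close>.\<close>

lemma strong_sum_pos_parts:
  assumes sa: "\<And>x. x \<in> M \<Longrightarrow> selfadjoint x" and orth: "pairwise (\<lambda>x y. x o\<^sub>L y = 0) M"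
    and bound: "\<And>x v. x \<in> M \<Longrightarrow> spectral_family x K v = v" and "0 \<le> K"
  obtains s where "selfadjoint s" "\<And>v. ((\<lambda>x. pos_part x v) has_sum s v) M"
proof -
  have norm: "norm (pos_part x v) \<le> K * norm (pos_support x v)" if x: "x \<in> M" for x v
  proof -
    have "norm (pos_part x w) \<le> K * norm w" for w
    proof (rule norm_le_if_form_le[OF pos_part_selfadjoint[OF sa[OF x]]])
      fix u
      have "pos_part x u \<bullet>\<^sub>R u \<le> K * (norm (pos_support x u))\<^sup>2"
        by (rule pos_part_form_le[OF sa[OF x] bound[OF x]])
      also have "\<dots> \<le> K * (norm u)\<^sup>2"
        using projection_pythagoras[OF pos_support_projection[OF sa[OF x]], of u] \<open>0 \<le> K\<close>
        by (intro mult_left_mono) simp_all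
      finally show "\<bar>pos_part x u \<bullet>\<^sub>R u\<bar> \<le> K * (norm u)\<^sup>2"
        using pos_part_nonneg[OF sa[OF x], of u] by simp
    qed
    from this[of "pos_support x v"] show ?thesis
      by (simp add: pos_part_support(1)[OF sa[OF x]] projection_idem[OF pos_support_projection[OF sa[OF x]]])
  qed
  have orth_parts: "pos_part x v \<bullet>\<^sub>R pos_part y v = 0" if xy: "x \<in> M" "y \<in> M" "x \<noteq> y" for x y v
  proof -
    have "x o\<^sub>L y = 0" using orth xy by (auto simp: pairwise_def)
    then have "x (y w) = 0" for w
      using orthogonal_commuting sa xy by blast
    then show ?thesis
      by (simp add: pos_part_support(1) sa xy selfadjoint_re_inner re_inner_simps)
  qed
  have square_sum: "(\<Sum>x\<in>F. (norm (pos_part x v))\<^sup>2) \<le> K\<^sup>2 * (norm v)\<^sup>2" if F: "finite F" "F \<subseteq> M" for F v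
  proof -
    have "(\<Sum>x\<in>F. (norm (pos_part x v))\<^sup>2) \<le> (\<Sum>x\<in>F. (K * norm (pos_support x v))\<^sup>2)"
      using norm F by (intro sum_mono power_mono) auto
    also have "\<dots> = K\<^sup>2 * (\<Sum>x\<in>F. (norm (pos_support x v))\<^sup>2)"
      by (simp add: power_mult_distrib sum_distrib_left)
    also have "\<dots> \<le> K\<^sup>2 * (norm v)\<^sup>2"
      using pos_support_bessel[OF sa orth F] by (intro mult_left_mono) auto
    finally show ?thesis .
  qed
  have norm_sum: "norm (\<Sum>x\<in>F. pos_part x v) \<le> K * norm v" if F: "finite F" "F \<subseteq> M" for F v
  proof (rule power2_le_imp_le)
    have "(norm (\<Sum>x\<in>F. pos_part x v))\<^sup>2 = (\<Sum>x\<in>F. (norm (pos_part x v))\<^sup>2)"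
      by (rule orthogonal_sum_norm[OF F(1)]) (use orth_parts F in blast)
    then show "(norm (\<Sum>x\<in>F. pos_part x v))\<^sup>2 \<le> (K * norm v)\<^sup>2"
      using square_sum[OF F] by (simp add: power_mult_distrib)
  qed (simp add: \<open>0 \<le> K\<close>)
  define T where "T F = (\<Sum>x\<in>F. pos_part x)" for F :: "('a \<Rightarrow>\<^sub>L 'a) set"
  have T_app: "T F v = (\<Sum>x\<in>F. pos_part x v)" for F v
    by (simp add: T_def blinfun.sum_left)
  have "\<exists>w. ((\<lambda>F. T F v) \<longlongrightarrow> w) (finite_subsets_at_top M)" for v
    using orthogonal_summable_on[OF orth_parts square_sum]
    by (simp add: summable_on_def has_sum_def T_app)
  moreover have "\<forall>\<^sub>F F in finite_subsets_at_top M. \<forall>v. norm (T F v) \<le> K * norm v"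
    by (rule eventually_finite_subsets_at_top_weakI) (simp add: T_app norm_sum)
  ultimately obtain s :: "'a \<Rightarrow>\<^sub>L 'a" where s: "\<And>v. ((\<lambda>F. T F v) \<longlongrightarrow> s v) (finite_subsets_at_top M)"
    by (rule pointwise_limit_operator[OF finite_subsets_at_top_neq_bot]) (erule that)
  have "\<forall>\<^sub>F F in finite_subsets_at_top M. selfadjoint (T F)"
    by (rule eventually_finite_subsets_at_top_weakI)
       (unfold T_def, rule selfadjoint_sum, rule pos_part_selfadjoint, use sa in blast)
  then have "selfadjoint s"
    by (rule selfadjoint_pointwise_limit[OF finite_subsets_at_top_neq_bot s])
  then show ?thesis using that s by (simp add: has_sum_def T_app)
qed

section \<open>The supremum in the spectral order\<close>

lemma finite_nonempty_subsets_at_top_le: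
  assumes "M \<noteq> {}" shows "finite_nonempty_subsets_at_top M \<le> finite_subsets_at_top M"
proof (rule filter_leI)
  fix P assume "eventually P (finite_subsets_at_top M)"
  then obtain X where X: "finite X" "X \<subseteq> M" "\<forall>Y. finite Y \<and> X \<subseteq> Y \<and> Y \<subseteq> M \<longrightarrow> P Y"
    unfolding eventually_finite_subsets_at_top by (elim exE conjE)
  obtain a where "a \<in> M" using assms by blast
  with X show "eventually P (finite_nonempty_subsets_at_top M)"
    unfolding eventually_finite_nonempty_subsets_at_top[OF assms]
    by (intro bexI[of _ "insert a X"]) (auto simp: finite_nonempty_subsets_def)
qed

lemma finite_nonempty_subsets_at_top_neq_bot:
  assumes "M \<noteq> {}" shows "finite_nonempty_subsets_at_top M \<noteq> bot"
  unfolding trivial_limit_def eventually_finite_nonempty_subsets_at_top[OF assms] by blast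

text \<open>Every element of \<open>M\<close> commutes with \<open>s\<close>, so spectral projections can be compared through forms:
  \<open>x \<le> x\<^sup>+ \<le> s\<close> for the upper bound; for leastness, negative parameters are settled by the two
  distinct elements, and nonnegative ones by adding up the bounds of the \<open>x\<^sup>+\<close> with Bessel.\<close>

lemma strong_sum_is_spectral_sup:
  assumes sa: "\<And>x. x \<in> M \<Longrightarrow> selfadjoint x" and orth: "pairwise (\<lambda>x y. x o\<^sub>L y = 0) M"
    and two: "a \<in> M" "b \<in> M" "a \<noteq> b"
    and s: "selfadjoint s" "\<And>v. ((\<lambda>x. pos_part x v) has_sum s v) M"
  shows "x \<in> M \<Longrightarrow> x \<preceq>\<^sub>s s"
    and "selfadjoint u \<Longrightarrow> (\<And>x. x \<in> M \<Longrightarrow> x \<preceq>\<^sub>s u) \<Longrightarrow> s \<preceq>\<^sub>s u"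
proof -
  have prod0: "x (y v) = 0" if "x \<in> M" "y \<in> M" "x \<noteq> y" for x y v
    using orth that orthogonal_commuting(1)[OF sa sa] by (auto simp: pairwise_def)
  have comm: "commuting x s" if x: "x \<in> M" for x
    unfolding commuting_def
  proof
    fix v
    have "x (pos_part y v) = pos_part y (x v)" if y: "y \<in> M" for y
    proof (cases "x = y")
      case True
      then show ?thesis using pos_part_support[OF sa[OF x]] by simp
    next
      case False
      then show ?thesis
        using pos_part_support(1)[OF sa[OF y], of v] pos_part_support(2)[OF sa[OF y], of "x v"]
          prod0[OF x y False] prod0[OF y x False[symmetric]] by (simp add: blinfun.zero_right)
    qed
    then have "((\<lambda>y. x (pos_part y v)) has_sum s (x v)) M"
      using s(2)[of "x v"] by (simp cong: has_sum_cong)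
    moreover have "((\<lambda>y. x (pos_part y v)) has_sum x (s v)) M"
      using has_sum_bounded_linear[OF blinfun.bounded_linear_right[of x] s(2)[of v]] by (simp add: o_def)
    ultimately show "x (s v) = s (x v)" by (metis has_sum_unique)
  qed
  have s_form: "((\<lambda>x. pos_part x v \<bullet>\<^sub>R v) has_sum s v \<bullet>\<^sub>R v) M" for v
    using has_sum_bounded_linear[OF re_inner.bounded_linear_left[of v] s(2)[of v]] by (simp add: o_def)
  have ge: "x v \<bullet>\<^sub>R v \<le> s v \<bullet>\<^sub>R v" if x: "x \<in> M" for x v
  proof -
    have "(\<Sum>y\<in>{x}. pos_part y v \<bullet>\<^sub>R v) \<le> s v \<bullet>\<^sub>R v"
      by (rule finite_sum_le_has_sum[OF s_form]) (use x pos_part_nonneg sa in auto)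
    then show ?thesis using pos_part_ge[OF sa[OF x], of v] by simp
  qed
  show "x \<preceq>\<^sub>s s" if x: "x \<in> M"
    unfolding spectral_le_iff_range[OF sa[OF x] s(1)]
  proof (intro allI impI)
    fix l v assume v: "spectral_family s l v = v"
    show "spectral_family x l v = v"
    proof (rule spectral_projection_range_subset[OF spectral_family_projection[OF s(1)]
          spectral_family_projection[OF sa[OF x]] _ _ v])
      show "commuting (spectral_family s l) (spectral_family x l)"
        using spectral_projections_commute[OF s(1) sa[OF x] spectral_family_projection[OF s(1)]
            spectral_family_projection[OF sa[OF x]] commuting_sym[OF comm[OF x]]] .
    qed (simp add: ge[OF x])
  qed
  show "s \<preceq>\<^sub>s u" if u: "selfadjoint u" and upper: "\<And>x. x \<in> M \<Longrightarrow> x \<preceq>\<^sub>s u"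
    unfolding spectral_le_iff_range[OF s(1) u]
  proof (intro allI impI)
    fix l v assume v: "spectral_family u l v = v"
    have fixed: "spectral_family x l v = v" if "x \<in> M" for x
      using upper[OF that] v spectral_le_iff_range[OF sa[OF that] u] by blast
    show "spectral_family s l v = v"
    proof (cases "l < 0")
      case True
      have "a o\<^sub>L b = 0" using orth two by (auto simp: pairwise_def)
      then have "v = 0"
        using orthogonal_negative_trivial[OF sa sa _ True fixed fixed] two by blast
      then show ?thesis by (simp add: blinfun.zero_right)
    next
      case False
      show ?thesis
      proof (rule ccontr)
        assume neq: "spectral_family s l v \<noteq> v"
        define w where "w = v - spectral_family s l v"
        have "spectral_family s l w = 0"
          by (simp add: w_def blinfun.bilinear_simps projection_idem[OF spectral_familyD(1)[OF s(1)]])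
        then have "l * (norm w)\<^sup>2 < s w \<bullet>\<^sub>R w"
          using neq by (intro spectral_familyD(4)[OF s(1)]) (auto simp: w_def)
        moreover have "s w \<bullet>\<^sub>R w \<le> l * (norm w)\<^sup>2"
        proof (rule has_sum_le_finite_sums[OF s_form])
          fix F assume F: "finite F" "F \<subseteq> M"
          have "spectral_family x l w = w" if x: "x \<in> M" for x
            using commuting_apply[OF spectral_projections_commute[OF sa[OF x] s(1)
                spectral_family_projection[OF sa[OF x]] spectral_family_projection[OF s(1)] comm[OF x]], of l l v]
            by (simp add: w_def blinfun.bilinear_simps fixed[OF x])
          then have "(\<Sum>x\<in>F. pos_part x w \<bullet>\<^sub>R w) \<le> (\<Sum>x\<in>F. l * (norm (pos_support x w))\<^sup>2)"
            using F sa by (intro sum_mono pos_part_form_le) auto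
          also have "\<dots> = l * (\<Sum>x\<in>F. (norm (pos_support x w))\<^sup>2)"
            by (simp add: sum_distrib_left)
          also have "\<dots> \<le> l * (norm w)\<^sup>2"
            using False by (intro mult_left_mono pos_support_bessel[OF sa orth F]) auto
          finally show "(\<Sum>x\<in>F. pos_part x w \<bullet>\<^sub>R w) \<le> l * (norm w)\<^sup>2" .
        qed
        ultimately show False by simp
      qed
    qed
  qed
qed

lemma spectral_Sup_eqI:
  assumes sup: "is_spectral_sup A M s"
  shows "spectral_Sup A M = s"
  unfolding spectral_Sup_def
proof (rule the_equality[where P = "is_spectral_sup A M", OF sup])
  fix t assume "is_spectral_sup A M t"
  with sup show "t = s"
    by (intro spectral_le_antisym) (auto simp: is_spectral_sup_def sa_part_def)
qed

theorem corollary2p9: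
  fixes A M :: "('a::complex_hilbert_space \<Rightarrow>\<^sub>L 'a) set"
  assumes "von_neumann_algebra A"
    and "M \<subseteq> sa_part A"
    and "M \<noteq> {}"
    and "pairwise (\<lambda>x y. x o\<^sub>L y = 0) M"
    and "spectral_bdd_above A M"
    and "\<not> is_singleton M"
  shows "is_spectral_sup A M (spectral_Sup A M) \<and>
    limitin strong_operator_topology (\<lambda>F. \<Sum>x\<in>F. pos_part x) (spectral_Sup A M)
      (finite_nonempty_subsets_at_top M)"
proof -
  have sa: "selfadjoint x" and mem: "x \<in> A" if "x \<in> M" for x
    using assms(2) that by (auto simp: sa_part_def)
  obtain a where a: "a \<in> M" using assms(3) by blast
  obtain b where b: "b \<in> M" "a \<noteq> b"
  proof (rule ccontr)
    assume "\<not> thesis"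
    then have "M = {a}" using a that by auto
    then show False using assms(6) by (simp add: is_singleton_def)
  qed
  obtain u where u: "u \<in> sa_part A" "\<And>x. x \<in> M \<Longrightarrow> x \<preceq>\<^sub>s u"
    using assms(5) by (auto simp: spectral_bdd_above_def)
  have u_sa: "selfadjoint u" using u(1) by (simp add: sa_part_def)
  \<comment> \<open>The spectral family of \<open>u\<close>, hence that of every \<open>x \<in> M\<close>, has reached 1 at the norm of \<open>u\<close>.\<close>
  have "spectral_family x (norm u) v = v" if "x \<in> M" for x v
    using u(2)[OF that] spectral_family_above_norm[OF u_sa] spectral_le_iff_range[OF sa[OF that] u_sa] by blast
  then obtain s where s: "selfadjoint s" "\<And>v. ((\<lambda>x. pos_part x v) has_sum s v) M"
    using strong_sum_pos_parts[OF sa assms(4) _ norm_ge_zero] by metis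
  have lim: "limitin strong_operator_topology (\<lambda>F. \<Sum>x\<in>F. pos_part x) s (finite_nonempty_subsets_at_top M)"
    unfolding limitin_strong_iff blinfun.sum_left
    using s(2) tendsto_mono[OF finite_nonempty_subsets_at_top_le[OF assms(3)]] by (auto simp: has_sum_def)
  have alg: "closed_algebra A" "closedin strong_operator_topology A"
    using assms(1) by (simp_all add: von_neumann_algebra_def closed_algebra_cstar)
  have "(\<Sum>x\<in>F. pos_part x) \<in> A" if "finite F" "F \<subseteq> M" for F
    using that by (induction F rule: finite_induct)
      (auto intro!: closed_algebraD[OF alg(1)] pos_part_in_algebra[OF sa alg(1) mem])
  then have "\<forall>\<^sub>F F in finite_nonempty_subsets_at_top M. (\<Sum>x\<in>F. pos_part x) \<in> A"
    unfolding eventually_finite_nonempty_subsets_at_top[OF assms(3)]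
    using a by (intro bexI[of _ "{a}"]) (auto simp: finite_nonempty_subsets_def)
  then have "s \<in> A"
    by (rule limitin_closedin[OF lim alg(2) _ finite_nonempty_subsets_at_top_neq_bot[OF assms(3)]])
  then have "is_spectral_sup A M s"
    unfolding is_spectral_sup_def
    using strong_sum_is_spectral_sup[OF sa assms(4) a b s] s(1) by (auto simp: sa_part_def)
  then show ?thesis using lim by (simp add: spectral_Sup_eqI)
qed

end
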